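(* A connected graph $G$ is $2$-stress regular if and only if it is isomorphic to one of the graphs $H_1$, $H_2$, $H_3$ on six vertices defined as follows. $H_1$ has vertex set $\{1,2,3,4,5,6\}$ and the $11$ edges $12,13,14,23,24,34,15,25,36,46,56$ (that is, a complete graph $K_4$ on $\{1,2,3,4\}$ together with an edge $56$, where $5$ is also adjacent to $1,2$ and $6$ is also adjacent to $3,4$). $H_2$ has vertex set $\{1,2,3,4,5,6\}$ and the $9$ edges $12,13,23,45,46,56,14,25,36$ (the triangular prism, a $3$-regular graph). $H_3$ has vertex set $\{1,2,3,4,5,6\}$ and all edges except $14,25,36$ (the octahedron $K_{2,2,2}$, a $4$-regular graph).
   Context: Graphs are finite, undirected and simple; $ij$ denotes the edge joining $i$ and $j$. A geodesic is a shortest path between two vertices (a path and its reverse are the same geodesic); it passes through a vertex if that vertex is an internal vertex of it. The stress of a vertex is the number of geodesics in $G$ passing through it. A graph is $k$-stress regular if all of its vertices have stress $k$. *)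

theory Defs
  imports "Graph_Theory.Graph_Theory"
begin

text \<open>
  A finite simple undirected graph is a graph in the sense of the locale
  \<open>pair_graph\<close>: a finite, symmetric, loop-free set of pairs, where the edge \<open>ij\<close> is
  represented by the two pairs \<open>(i, j)\<close> and \<open>(j, i)\<close>.  Note that \<open>connected\<close>
  excludes the null graph, which would be vacuously stress regular.
\<close>

definition geodesic :: "'a pair_pre_digraph \<Rightarrow> 'a vwalk \<Rightarrow> bool" where
  "geodesic G p \<longleftrightarrow> vpath p (with_proj G) \<and>
     (\<forall>q. vpath q (with_proj G) \<and> hd q = hd p \<and> last q = last p
          \<longrightarrow> vwalk_length p \<le> vwalk_length q)"

text \<open>
  The internal vertices of \<open>p\<close> are those of \<open>butlast (tl p)\<close>.  A path is counted
  together with its reverse: the undirected geodesic is the set \<open>{p, rev p}\<close>.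
\<close>

definition stress :: "'a pair_pre_digraph \<Rightarrow> 'a \<Rightarrow> nat" where
  "stress G v = card {{p, rev p} | p. geodesic G p \<and> v \<in> set (butlast (tl p))}"

definition stress_regular :: "nat \<Rightarrow> 'a pair_pre_digraph \<Rightarrow> bool" where
  "stress_regular k G \<longleftrightarrow> (\<forall>v \<in> pverts G. stress G v = k)"

definition undirected :: "'a set \<Rightarrow> 'a rel \<Rightarrow> 'a pair_pre_digraph" where
  "undirected V E = \<lparr> pverts = V, parcs = E \<union> E\<inverse> \<rparr>"

definition H1 :: "nat pair_pre_digraph" where
  "H1 = undirected {1, 2, 3, 4, 5, 6}
     {(1,2), (1,3), (1,4), (2,3), (2,4), (3,4), (1,5), (2,5), (3,6), (4,6), (5,6)}"

definition H2 :: "nat pair_pre_digraph" where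
  "H2 = undirected {1, 2, 3, 4, 5, 6}
     {(1,2), (1,3), (2,3), (4,5), (4,6), (5,6), (1,4), (2,5), (3,6)}"

definition H3 :: "nat pair_pre_digraph" where
  "H3 = undirected {1, 2, 3, 4, 5, 6}
     ({(i, j). i \<in> {1, 2, 3, 4, 5, 6} \<and> j \<in> {1, 2, 3, 4, 5, 6} \<and> i < j}
        - {(1,4), (2,5), (3,6)})"

end

theory Submission
  imports Defs
begin

text \<open>
The proof reduces stress to a local condition. Call a pair of non-adjacent neighbours of a vertex \<open>v\<close>
a gap at \<open>v\<close>; the gaps correspond to the geodesics with two edges through \<open>v\<close>. If all stresses
are two, there is no geodesic with three edges (\<open>no_geodesic_4\<close>): its two internal vertices would already
have their stress exhausted by it and its subpaths, which leaves no room for the geodesics through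
its end vertices. So the diameter is at most two, stress counts gaps, and a connected graph is 2-stress
regular if and only if it has diameter at most two and exactly two gaps at every vertex
(\<open>stress_regular_2_iff\<close>).

The classification looks at the two gaps at an arbitrary vertex \<open>v\<close> and reconstructs the graph around it,
using that a third gap at any vertex is a contradiction and that vertices at distance two have common
neighbours. If the gaps at \<open>v\<close> are disjoint, the graph is the octahedron (\<open>disjoint_gaps_imp_H3\<close>). Otherwise
they are \<open>{a, b}\<close> and \<open>{a, c}\<close>. If \<open>v\<close> has a neighbour besides \<open>a, b, c\<close>, the graph is the first one, with
\<open>v\<close> in the complete graph on four vertices (\<open>full_nbr_imp_H1\<close>). If not, the neighbourhood of \<open>a\<close> is
\<open>v\<close> with two further adjacent vertices, and \<open>b\<close> and \<open>c\<close> have either one further neighbour each, which gives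
the prism (\<open>single_outer_nbrs_imp_H2\<close>), or two common ones, which gives the first graph with \<open>v\<close> outside
the complete graph (\<open>common_outer_nbrs_imp_H1\<close>).

Conversely, both parts of the local condition are invariant under isomorphism (\<open>two_gaps_transfer\<close>) and hold
in the three concrete graphs.
\<close>

section \<open>Geodesics as shortest walks\<close>

lemma length_vwalk_to_vpath: "length (vwalk_to_vpath p) \<le> length p"
proof (induct p rule: vwalk_to_vpath_induct3)
  case (in_set x xs)
  then show ?case using length_dropWhile_le[of "\<lambda>y. y \<noteq> x" xs] by simp
qed auto

lemma vwalk_append_iff:
  assumes "p \<noteq> []" "q \<noteq> []"
  shows "vwalk (p @ q) G \<longleftrightarrow> vwalk p G \<and> vwalk q G \<and> (last p, hd q) \<in> arcs_ends G"
  using assms by (auto simp: vwalk_def vwalk_arcs_append)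

text \<open>
Minimality among paths is the same as minimality among walks, because a walk can be shortcut to a
path with the same ends. Walks are what one gets by replacing a piece of a geodesic.
\<close>

lemma geodesic_iff:
  "geodesic G p \<longleftrightarrow> vwalk p (with_proj G) \<and>
     (\<forall>q. vwalk q (with_proj G) \<and> hd q = hd p \<and> last q = last p \<longrightarrow> length p \<le> length q)"
    (is "?L \<longleftrightarrow> ?R")
proof
  assume L: ?L
  have "length p \<le> length q" if "vwalk q (with_proj G)" "hd q = hd p" "last q = last p" for q
  proof -
    have "vpath (vwalk_to_vpath q) (with_proj G)" "hd (vwalk_to_vpath q) = hd p"
      "last (vwalk_to_vpath q) = last p"
      using that by (simp_all add: vwalk_to_vpath_vpath vwalk_to_vpath_hd vwalk_to_vpath_last)
    with L have "length p - 1 \<le> length (vwalk_to_vpath q) - 1"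
      by (auto simp: geodesic_def)
    moreover have "q \<noteq> []" using that by auto
    ultimately show ?thesis
      using length_vwalk_to_vpath[of q] vwalk_to_vpath_nonempty[of q]
      by (cases "vwalk_to_vpath q") auto
  qed
  with L show ?R by (auto simp: geodesic_def)
next
  assume R: ?R
  have "distinct p"
  proof (rule ccontr)
    assume "\<not> distinct p"
    then obtain xs ys zs y where p: "p = xs @ [y] @ ys @ [y] @ zs"
      using not_distinct_decomp by blast
    have "vwalk (xs @ [y] @ zs) (with_proj G)"
    proof -
      have "vwalk (xs @ [y]) (with_proj G)"
        using R p vwalkI_append_l[of "xs @ [y]" "ys @ [y] @ zs" "with_proj G"] by simp
      moreover have "vwalk ([y] @ zs) (with_proj G)"
        using R p vwalkI_append_r[of "[y] @ zs" "xs @ [y] @ ys" "with_proj G"] by simp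
      ultimately show ?thesis
        using vwalk_append_iff[of "xs @ [y]" zs "with_proj G"] vwalk_append_iff[of "[y]" zs "with_proj G"]
        by (cases "zs = []") auto
    qed
    moreover have "hd (xs @ [y] @ zs) = hd p" "last (xs @ [y] @ zs) = last p"
      using p by (auto simp: hd_append last_append)
    ultimately show False using R p by force
  qed
  with R show ?L by (auto simp: geodesic_def intro!: diff_le_mono)
qed

lemma geodesic_le:
  assumes "geodesic G p" "vwalk q (with_proj G)" "hd q = hd p" "last q = last p"
  shows "length p \<le> length q"
  using assms by (simp add: geodesic_iff)

lemma geodesic_infix:
  assumes "geodesic G (p @ q @ r)" and "q \<noteq> []"
  shows "geodesic G q"
proof -
  have W: "vwalk (p @ q @ r) (with_proj G)" using assms by (simp add: geodesic_iff)
  have q: "vwalk q (with_proj G)"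
    using vwalkI_append_l[of q r "with_proj G"] vwalkI_append_r[of "q @ r" p "with_proj G"] W assms(2)
    by simp
  have "length q \<le> length q'"
    if "vwalk q' (with_proj G)" "hd q' = hd q" "last q' = last q" for q'
  proof -
    have "q' \<noteq> []" using that by auto
    have "vwalk (p @ q' @ r) (with_proj G)"
      using W that \<open>q' \<noteq> []\<close> assms(2)
      by (cases "p = []"; cases "r = []") (auto simp: vwalk_def vwalk_arcs_append)
    moreover have "hd (p @ q' @ r) = hd (p @ q @ r)" "last (p @ q' @ r) = last (p @ q @ r)"
      using that \<open>q' \<noteq> []\<close> assms(2) by (auto simp: hd_append last_append)
    ultimately have "length (p @ q @ r) \<le> length (p @ q' @ r)"
      using assms(1) unfolding geodesic_iff by blast
    then show ?thesis by simp
  qed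
  with q show ?thesis by (simp add: geodesic_iff)
qed

section \<open>Stress as the number of gaps\<close>

abbreviation (in pair_pre_digraph) adj :: "'a \<Rightarrow> 'a \<Rightarrow> bool" (infix \<open>\<sim>\<close> 50) where
  "u \<sim> v \<equiv> (u, v) \<in> parcs G"

text \<open>
An induced path on three vertices with centre \<open>v\<close>, given by its ends.
\<close>

definition (in pair_pre_digraph) gap :: "'a \<Rightarrow> 'a \<Rightarrow> 'a \<Rightarrow> bool" where
  "gap v x y \<longleftrightarrow> v \<sim> x \<and> v \<sim> y \<and> x \<noteq> y \<and> \<not> x \<sim> y"

definition (in pair_pre_digraph) gaps :: "'a \<Rightarrow> 'a set set" where
  "gaps v = {{x, y} | x y. gap v x y}"

definition (in pair_pre_digraph) diameter_le_2 :: bool where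
  "diameter_le_2 \<longleftrightarrow>
     (\<forall>u\<in>pverts G. \<forall>w\<in>pverts G. u \<noteq> w \<longrightarrow> \<not> u \<sim> w \<longrightarrow> (\<exists>x. u \<sim> x \<and> x \<sim> w))"

context pair_graph
begin

lemma adj_sym: "u \<sim> v \<Longrightarrow> v \<sim> u"
  by (rule arcs_symmetric)

lemma adj_commute: "u \<sim> v \<longleftrightarrow> v \<sim> u"
  using adj_sym by blast

lemma adj_irrefl [simp]: "\<not> u \<sim> u"
  using no_loops' by blast

lemma gap_commute: "gap v x y \<longleftrightarrow> gap v y x"
  by (auto simp: gap_def adj_commute)

lemma gap_in_gaps: "{x, y} \<in> gaps v \<longleftrightarrow> gap v x y"
  by (auto simp: gaps_def doubleton_eq_iff gap_commute)

lemma geodesic_3_iff: "geodesic G [a, b, c] \<longleftrightarrow> gap b a c"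
proof
  assume L: "geodesic G [a, b, c]"
  then have ab: "a \<sim> b" "b \<sim> c" and V: "a \<in> pverts G" "c \<in> pverts G"
    by (auto simp: geodesic_iff vwalk_def)
  have "\<not> a \<sim> c"
  proof
    assume "a \<sim> c"
    then have "vwalk [a, c] (with_proj G)" using V by (auto simp: vwalk_def)
    from geodesic_le[OF L this] show False by simp
  qed
  moreover have "a \<noteq> c" using L by (auto simp: geodesic_def vpath_def)
  ultimately show "gap b a c" using ab by (auto simp: gap_def adj_commute)
next
  assume R: "gap b a c"
  then have "vwalk [a, b, c] (with_proj G)"
    by (auto simp: gap_def vwalk_def adj_commute dest: wellformed')
  moreover have "length [a, b, c] \<le> length q"
    if "vwalk q (with_proj G)" "hd q = a" "last q = c" for q
    using R that
    by (cases q rule: vwalk_arcs.cases; cases "tl (tl q)") (auto simp: vwalk_def gap_def)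
  ultimately show "geodesic G [a, b, c]" by (simp add: geodesic_iff)
qed

lemma geodesic_4_iff:
  "geodesic G [a, b, c, d] \<longleftrightarrow>
     a \<sim> b \<and> b \<sim> c \<and> c \<sim> d \<and> a \<noteq> d \<and> \<not> a \<sim> d \<and> (\<forall>x. \<not> (a \<sim> x \<and> x \<sim> d))"
    (is "?L \<longleftrightarrow> ?R")
proof
  assume L: ?L
  then have ab: "a \<sim> b" "b \<sim> c" "c \<sim> d" and V: "a \<in> pverts G" "d \<in> pverts G"
    by (auto simp: geodesic_iff vwalk_def)
  have short: "\<not> vwalk q (with_proj G)" if "hd q = a" "last q = d" "length q < 4" for q
    using geodesic_le[OF L, of q] that by auto
  have "a \<noteq> d" using short[of "[a]"] V by (auto simp: vwalk_def)
  moreover have "\<not> a \<sim> d" using short[of "[a, d]"] V by (auto simp: vwalk_def)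
  moreover have "\<not> (a \<sim> x \<and> x \<sim> d)" for x
    using short[of "[a, x, d]"] V by (auto simp: vwalk_def dest: wellformed')
  ultimately show ?R using ab by blast
next
  assume R: ?R
  then have "vwalk [a, b, c, d] (with_proj G)"
    by (auto simp: vwalk_def dest: wellformed')
  moreover have "length [a, b, c, d] \<le> length q"
    if "vwalk q (with_proj G)" "hd q = a" "last q = d" for q
    using R that
    by (cases q rule: vwalk_arcs.cases; cases "tl (tl q)"; cases "tl (tl (tl q))")
       (auto simp: vwalk_def)
  ultimately show ?L by (simp add: geodesic_iff)
qed

lemma no_third_geodesic:
  assumes "stress G v = 2"
    and "geodesic G p" "v \<in> set (butlast (tl p))"
    and "geodesic G q" "v \<in> set (butlast (tl q))"
    and "geodesic G r" "v \<in> set (butlast (tl r))"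
  shows "q \<in> {p, rev p} \<or> r \<in> {p, rev p} \<or> r \<in> {q, rev q}"
proof (rule ccontr)
  assume neg: "\<not> ?thesis"
  let ?S = "{{p, rev p} | p. geodesic G p \<and> v \<in> set (butlast (tl p))}"
  have c: "card ?S = 2" using assms(1) by (simp add: stress_def)
  then have fin: "finite ?S" by (intro card_ge_0_finite) linarith
  have "{{p, rev p}, {q, rev q}, {r, rev r}} \<subseteq> ?S"
    using assms by auto
  from card_mono[OF fin this] have "card {{p, rev p}, {q, rev q}, {r, rev r}} \<le> 2"
    unfolding c .
  moreover have "card {{p, rev p}, {q, rev q}, {r, rev r}} = 3"
    using neg by (auto simp: card_insert_if doubleton_eq_iff)
  ultimately show False by linarith
qed

lemma geodesic_through_gap:
  assumes "geodesic G p" "v \<in> set (butlast (tl p))"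
  obtains x y where "gap v x y"
proof -
  obtain s t where st: "butlast (tl p) = s @ v # t"
    using assms(2) by (meson split_list)
  define x where "x = last (hd p # s)"
  define y where "y = hd (t @ [last p])"
  have ne: "tl p \<noteq> []" "p \<noteq> []" using assms(2) by auto
  then have "p = (hd p # butlast (tl p)) @ [last p]"
    by (metis append_Cons append_butlast_last_id last_tl list.collapse)
  also have "\<dots> = (hd p # s) @ [v] @ (t @ [last p])"
    by (simp add: st)
  also have "\<dots> = (butlast (hd p # s) @ [x]) @ [v] @ (y # tl (t @ [last p]))"
    by (simp only: x_def y_def append_butlast_last_id list.collapse list.distinct snoc_eq_iff_butlast
        append_is_Nil_conv list.simps not_False_eq_True simp_thms)
  finally have "p = butlast (hd p # s) @ [x, v, y] @ tl (t @ [last p])" by simp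
  then have "geodesic G [x, v, y]"
    using assms(1) geodesic_infix by (metis list.distinct(1))
  then show ?thesis using that[of x y] by (simp add: geodesic_3_iff)
qed

text \<open>
A geodesic \<open>abcd\<close> with three edges already uses up the stress of \<open>b\<close> (by \<open>abc\<close> and \<open>abcd\<close>) and that of
\<open>c\<close> (by \<open>bcd\<close> and \<open>abcd\<close>), so \<open>{a, c}\<close> is the only gap at \<open>b\<close> and \<open>{b, d}\<close> the only gap at \<open>c\<close>. The end
\<open>a\<close> has stress two as well and hence a gap. If some other neighbour \<open>x\<close> of \<open>a\<close> were not adjacent to
\<open>b\<close>, then \<open>xabc\<close> would be a third geodesic through \<open>b\<close>. So all neighbours of \<open>a\<close> are adjacent or
equal to \<open>b\<close>, and the gap at \<open>a\<close> is a further gap at \<open>b\<close>.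
\<close>

lemma no_geodesic_4:
  assumes "stress_regular 2 G"
  shows "\<not> geodesic G [a, b, c, d]"
proof
  assume abcd: "geodesic G [a, b, c, d]"
  then have *: "a \<sim> b" "b \<sim> c" "c \<sim> d" "a \<noteq> d" "\<not> a \<sim> d" "\<And>x. a \<sim> x \<Longrightarrow> \<not> x \<sim> d"
    by (auto simp: geodesic_4_iff)
  then have dist: "distinct [a, b, c, d]" by auto
  have st: "stress G a = 2" "stress G b = 2" "stress G c = 2"
    using assms * by (auto simp: stress_regular_def dest: wellformed')
  have abc: "geodesic G [a, b, c]" and bcd: "geodesic G [b, c, d]"
    using geodesic_infix[of G "[]" "[a, b, c]" "[d]"] geodesic_infix[of G "[a]" "[b, c, d]" "[]"] abcd
    by auto
  \<comment> \<open>The geodesics through \<open>b\<close> are \<open>abc\<close> and \<open>abcd\<close>, up to reversal.\<close>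
  have only_b: "p \<in> {[a, b, c], [c, b, a], [a, b, c, d], [d, c, b, a]}"
    if "geodesic G p" "b \<in> set (butlast (tl p))" for p
    using no_third_geodesic[OF st(2) abc _ abcd _ that] dist by auto
  have gap_b: "{x, y} = {a, c}" if "gap b x y" for x y
    using only_b[of "[x, b, y]"] that by (auto simp: geodesic_3_iff)
  have gap_c: "{x, y} = {b, d}" if "gap c x y" for x y
    using no_third_geodesic[OF st(3) bcd _ abcd _, of "[x, c, y]"] that dist
    by (auto simp: geodesic_3_iff)
  have nac: "\<not> a \<sim> c" using abc by (auto simp: geodesic_3_iff gap_def)
  have "{{p, rev p} | p. geodesic G p \<and> a \<in> set (butlast (tl p))} \<noteq> {}"
    using st(1) unfolding stress_def by force
  then obtain p where "geodesic G p" "a \<in> set (butlast (tl p))" by blast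
  then obtain x y where xy: "gap a x y" by (rule geodesic_through_gap)
  \<comment> \<open>Otherwise \<open>xabc\<close> is a geodesic: a common neighbour \<open>z\<close> of \<open>x\<close> and \<open>c\<close> would be adjacent
    to both \<open>a\<close> and \<open>d\<close>, by the uniqueness of the gaps at \<open>b\<close> and \<open>c\<close>.\<close>
  have near: "x \<sim> b" if "a \<sim> x" "x \<noteq> b" for x
  proof (rule ccontr)
    assume n: "\<not> x \<sim> b"
    have xc: "x \<noteq> c" using that nac by auto
    have "x \<noteq> d" using that * by auto
    have "\<not> x \<sim> c"
      using gap_c[of x b] n that * \<open>x \<noteq> d\<close> by (auto simp: gap_def adj_commute doubleton_eq_iff)
    moreover have "\<not> (x \<sim> z \<and> z \<sim> c)" for z
    proof
      assume z: "x \<sim> z \<and> z \<sim> c"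
      then have "z \<noteq> b" using n by auto
      have "z \<noteq> a" using z nac by auto
      have "z \<noteq> d" using z that *(6) adj_sym by blast
      then have "z \<sim> b" 
        using gap_c[of z b] z * \<open>z \<noteq> b\<close> by (auto simp: gap_def adj_commute doubleton_eq_iff)
      moreover have "z \<noteq> c" using z by auto
      ultimately have "z \<sim> a"
        using gap_b[of z a] * \<open>z \<noteq> a\<close> by (auto simp: gap_def adj_commute doubleton_eq_iff)
      moreover have "z \<sim> d"
        using gap_c[of z d] z * \<open>z \<noteq> d\<close> \<open>z \<noteq> b\<close> by (auto simp: gap_def adj_commute doubleton_eq_iff)
      ultimately show False using *(6) adj_sym by blast
    qed
    ultimately have "geodesic G [x, a, b, c]"
      using that * xc by (auto simp: geodesic_4_iff adj_commute)
    from only_b[OF this] show False using dist that by auto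
  qed
  have "x \<noteq> b" "y \<noteq> b" using near xy adj_sym unfolding gap_def by metis+
  then have "gap b x y" using near xy adj_sym unfolding gap_def by metis
  then have "c \<in> {x, y}" using gap_b by blast
  then show False using xy nac by (auto simp: gap_def)
qed

text \<open>
By connectedness two vertices are joined by a geodesic; if it had three or more edges, its first
four vertices would form a geodesic with three edges.
\<close>

lemma diameter_le_2_if_stress_regular:
  assumes "Digraph_Component.connected (with_proj G)" "stress_regular 2 G"
  shows diameter_le_2
  unfolding diameter_le_2_def
proof (intro ballI impI)
  fix u w assume uw: "u \<in> pverts G" "w \<in> pverts G" "u \<noteq> w" "\<not> u \<sim> w"
  let ?P = "\<lambda>p. vwalk p (with_proj G) \<and> hd p = u \<and> last p = w"
  have "u \<rightarrow>\<^sup>*\<^bsub>with_proj G\<^esub> w"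
    using symmetric_connected_imp_strongly_connected assms(1) pair_sym_arcs uw
    by (auto simp: strongly_connected_def)
  then obtain p0 where "?P p0" using reachable_vwalk_conv by blast
  then obtain p where p: "?P p" "\<And>q. ?P q \<Longrightarrow> length p \<le> length q"
    using ex_has_least_nat[of ?P p0 length] by blast
  then have g: "geodesic G p" by (auto simp: geodesic_iff)
  consider "p = []" | x where "p = [x]" | x y where "p = [x, y]" | x y z where "p = [x, y, z]"
    | x y z t r where "p = x # y # z # t # r"
    by (metis neq_Nil_conv)
  then show "\<exists>x. u \<sim> x \<and> x \<sim> w"
  proof cases
    case 5
    then have "geodesic G ([] @ [x, y, z, t] @ r)" using g by simp
    then have "geodesic G [x, y, z, t]" by (rule geodesic_infix) simp
    then show ?thesis using no_geodesic_4 assms(2) by blast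
  qed (use p uw in \<open>auto simp: vwalk_def\<close>)
qed

text \<open>
In diameter two the geodesics with an internal vertex are exactly the induced paths \<open>xvy\<close>, and
such a path, taken up to reversal, is determined by its centre and the gap \<open>{x, y}\<close>.
\<close>

lemma stress_eq_card_gaps:
  assumes diameter_le_2
  shows "stress G v = card (gaps v)"
proof -
  \<comment> \<open>\<open>F\<close> turns a gap at \<open>v\<close> into the corresponding path together with its reverse.\<close>
  define F where "F e = {[x, v, y] | x y. {x, y} = e}" for e
  have F: "F {x, y} = {[x, v, y], rev [x, v, y]}" for x y
    by (auto simp: F_def doubleton_eq_iff)
  have "\<exists>x y. p = [x, v, y] \<and> gap v x y"
    if p_geodesic: "geodesic G p" and v_inner: "v \<in> set (butlast (tl p))" for p
  proof -
    have no4: "\<not> geodesic G [x, y, z, t]" for x y z t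
      using assms by (auto simp: geodesic_4_iff diameter_le_2_def dest: wellformed')
    obtain x y z r where p: "p = x # y # z # r"
      using v_inner by (cases p; cases "tl p"; cases "tl (tl p)") auto
    have "r = []"
    proof (rule ccontr)
      assume "r \<noteq> []"
      then have "geodesic G ([] @ [x, y, z, hd r] @ tl r)" using p_geodesic p by simp
      then have "geodesic G [x, y, z, hd r]" by (rule geodesic_infix) simp
      then show False using no4 by blast
    qed
    then show ?thesis using p p_geodesic v_inner by (auto simp: geodesic_3_iff)
  qed
  then have "geodesic G p \<and> v \<in> set (butlast (tl p)) \<longleftrightarrow> (\<exists>x y. p = [x, v, y] \<and> gap v x y)" for p
    by (auto simp: geodesic_3_iff)
  then have "{{p, rev p} | p. geodesic G p \<and> v \<in> set (butlast (tl p))}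
      = {{[x, v, y], rev [x, v, y]} | x y. gap v x y}"
    by (intro Collect_cong) metis
  also have "\<dots> = F ` gaps v"
    unfolding gaps_def F[symmetric] by blast
  finally have "{{p, rev p} | p. geodesic G p \<and> v \<in> set (butlast (tl p))} = F ` gaps v" .
  moreover have "inj_on F (gaps v)"
    by (auto simp: inj_on_def gaps_def F doubleton_eq_iff)
  ultimately show ?thesis by (simp add: stress_def card_image)
qed

lemma stress_regular_2_iff:
  assumes "Digraph_Component.connected (with_proj G)"
  shows "stress_regular 2 G \<longleftrightarrow> diameter_le_2 \<and> (\<forall>v\<in>pverts G. card (gaps v) = 2)"
proof
  assume "stress_regular 2 G"
  then have diameter_le_2 using diameter_le_2_if_stress_regular assms by blast
  with \<open>stress_regular 2 G\<close> show "diameter_le_2 \<and> (\<forall>v\<in>pverts G. card (gaps v) = 2)"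
    by (simp add: stress_regular_def stress_eq_card_gaps)
next
  assume "diameter_le_2 \<and> (\<forall>v\<in>pverts G. card (gaps v) = 2)"
  then show "stress_regular 2 G"
    by (simp add: stress_regular_def stress_eq_card_gaps)
qed

end

section \<open>Isomorphism with the three graphs\<close>

lemma undirected_simps [simp]:
  "pverts (undirected V E) = V" "parcs (undirected V E) = E \<union> E\<inverse>"
  by (simp_all add: undirected_def)

text \<open>
An isomorphism in the sense of \<open>digraph_iso\<close> carries separate maps on vertices and on arcs. For graphs
whose arcs are pairs it is the same as a bijection of the vertices that preserves and reflects
adjacency. The bijection is taken from \<open>H\<close> to \<open>G\<close>, since it arises as a labelling of the vertices
of \<open>G\<close> by those of a concrete graph \<open>H\<close>.
\<close>

lemma digraph_iso_with_proj_iff: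
  assumes "pair_wf_digraph G" "pair_wf_digraph H"
  shows "digraph_iso (with_proj G) (with_proj H) \<longleftrightarrow>
    (\<exists>f. bij_betw f (pverts H) (pverts G) \<and>
       (\<forall>i\<in>pverts H. \<forall>j\<in>pverts H. (i, j) \<in> parcs H \<longleftrightarrow> (f i, f j) \<in> parcs G))"
    (is "?L \<longleftrightarrow> ?R")
proof
  assume ?L
  then obtain h where h: "pre_digraph.digraph_isomorphism (with_proj G) h"
    and H: "with_proj H = app_iso h (with_proj G)"
    by (auto simp: digraph_iso_def)
  have V: "pverts H = iso_verts h ` pverts G"
    using arg_cong[OF H, of verts] by simp
  have bij: "bij_betw (iso_verts h) (pverts G) (pverts H)"
    using h V by (auto simp: pre_digraph.digraph_isomorphism_def bij_betw_def)
  have A: "parcs H = (\<lambda>(u, v). (iso_verts h u, iso_verts h v)) ` parcs G"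
    using wf_digraph.arcs_ends_app_iso_eq[OF _ h] assms(1) arg_cong[OF H, of arcs_ends]
    by (simp add: wf_digraph_wp_iff)
  have adj: "(iso_verts h u, iso_verts h v) \<in> parcs H \<longleftrightarrow> (u, v) \<in> parcs G"
    if "u \<in> pverts G" "v \<in> pverts G" for u v
  proof
    assume "(iso_verts h u, iso_verts h v) \<in> parcs H"
    then obtain u' v' where e: "(u', v') \<in> parcs G"
      and eq: "iso_verts h u = iso_verts h u'" "iso_verts h v = iso_verts h v'"
      by (auto simp: A)
    have "u' \<in> pverts G" "v' \<in> pverts G"
      using e assms(1) by (simp_all add: pair_wf_digraph.in_arcsD1 pair_wf_digraph.in_arcsD2)
    then have "u = u'" "v = v'"
      using eq that bij inj_onD[of "iso_verts h" "pverts G"] by (simp_all add: bij_betw_def)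
    with e show "(u, v) \<in> parcs G" by simp
  qed (simp add: A rev_image_eqI)
  let ?f = "inv_into (pverts G) (iso_verts h)"
  have f: "bij_betw ?f (pverts H) (pverts G)" using bij by (rule bij_betw_inv_into)
  moreover have "(i, j) \<in> parcs H \<longleftrightarrow> (?f i, ?f j) \<in> parcs G"
    if "i \<in> pverts H" "j \<in> pverts H" for i j
    using adj[of "?f i" "?f j"] that bij_betw_inv_into_right[OF bij] bij_betwE[OF f] by simp
  ultimately show ?R by blast
next
  assume ?R
  then obtain f where f: "bij_betw f (pverts H) (pverts G)"
    and adj: "\<And>i j. i \<in> pverts H \<Longrightarrow> j \<in> pverts H \<Longrightarrow> (i, j) \<in> parcs H \<longleftrightarrow> (f i, f j) \<in> parcs G"
    by blast
  let ?g = "inv_into (pverts H) f"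
  let ?h = "\<lparr>iso_verts = ?g, iso_arcs = map_prod ?g ?g, iso_head = snd, iso_tail = fst\<rparr>"
  have g: "bij_betw ?g (pverts G) (pverts H)" using f by (rule bij_betw_inv_into)
  have sub: "parcs G \<subseteq> pverts G \<times> pverts G" "parcs H \<subseteq> pverts H \<times> pverts H"
    using assms by (auto dest: pair_wf_digraph.in_arcsD1 pair_wf_digraph.in_arcsD2)
  have "inj_on (map_prod ?g ?g) (parcs G)"
    using g by (intro inj_on_subset[OF map_prod_inj_on sub(1)]) (auto simp: bij_betw_def)
  moreover have "wf_digraph (with_proj G)" using assms(1) by (simp add: wf_digraph_wp_iff)
  ultimately have "pre_digraph.digraph_isomorphism (with_proj G) ?h"
    using g by (auto simp: pre_digraph.digraph_isomorphism_def bij_betw_def)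
  moreover have "parcs H = map_prod ?g ?g ` parcs G"
  proof (intro equalityI subsetI)
    fix e assume e: "e \<in> parcs H"
    obtain i j where ij: "e = (i, j)" by force
    with e sub have "i \<in> pverts H" "j \<in> pverts H" by auto
    then have "e = map_prod ?g ?g (f i, f j)" "(f i, f j) \<in> parcs G"
      using ij e adj bij_betw_inv_into_left[OF f] by auto
    then show "e \<in> map_prod ?g ?g ` parcs G" by blast
  next
    fix e assume "e \<in> map_prod ?g ?g ` parcs G"
    then obtain u w where uw: "e = (?g u, ?g w)" "(u, w) \<in> parcs G" by auto
    then have "u \<in> pverts G" "w \<in> pverts G" using sub by auto
    then show "e \<in> parcs H"
      using uw adj[of "?g u" "?g w"] bij_betw_inv_into_right[OF f] bij_betwE[OF g] by simp
  qed
  then have "with_proj H = app_iso ?h (with_proj G)"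
    using g by (simp add: app_iso_def with_proj_def bij_betw_def)
  ultimately show ?L unfolding digraph_iso_def by blast
qed

lemma H3_edges:
  "H3 = undirected {1, 2, 3, 4, 5, 6}
     {(1,2), (1,3), (1,5), (1,6), (2,3), (2,4), (2,6), (3,4), (3,5), (4,5), (4,6), (5,6)}"
proof -
  have "{(i, j). i \<in> {1, 2, 3, 4, 5, 6} \<and> j \<in> {1, 2, 3, 4, 5, 6} \<and> i < j} - {(1, 4), (2, 5), (3, 6)} =
      {(1,2), (1,3), (1,5), (1,6), (2,3), (2,4), (2,6), (3,4), (3,5), (4,5), (4,6), (5,6 :: nat)}"
    (is "?L = ?R")
  proof
    show "?L \<subseteq> ?R"
    proof (rule subrelI)
      fix i j assume "(i, j) \<in> ?L"
      then have "i \<in> {1, 2, 3, 4, 5, 6}" "j \<in> {1, 2, 3, 4, 5, 6}" "i < j"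
        "(i, j) \<notin> {(1, 4), (2, 5), (3, 6)}"
        by blast+
      then show "(i, j) \<in> ?R"
        by (elim insertE emptyE; simp)
    qed
    show "?R \<subseteq> ?L" by simp
  qed
  then show ?thesis by (simp only: H3_def)
qed

lemma pair_graph_undirected:
  assumes "finite V" "E \<subseteq> V \<times> V" "\<And>x. (x, x) \<notin> E"
  shows "pair_graph (undirected V E)"
proof
  show "finite (parcs (undirected V E))"
    using assms finite_subset[OF assms(2)] by auto
  show "symmetric (with_proj (undirected V E))"
    by (auto simp: symmetric_def sym_def)
qed (use assms in auto)

lemma pair_graph_H1: "pair_graph H1"
  and pair_graph_H2: "pair_graph H2"
  and pair_graph_H3: "pair_graph H3"
  unfolding H1_def H2_def H3_edges by (rule pair_graph_undirected; auto)+

context pair_graph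
begin

lemma digraph_iso_listI:
  assumes "pair_graph H" "pverts H = {1, 2, 3, 4, 5, 6}"
    and "length vs = 6" "distinct vs" "set vs = pverts G"
    and edge: "\<And>i j. i \<in> {1, 2, 3, 4, 5, 6} \<Longrightarrow> j \<in> {1, 2, 3, 4, 5, 6} \<Longrightarrow> i < j \<Longrightarrow>
      (i, j) \<in> parcs H \<longleftrightarrow> vs ! (i - 1) \<sim> vs ! (j - 1)"
  shows "digraph_iso (with_proj G) (with_proj H)"
proof -
  interpret H: pair_graph H by fact
  have V: "pverts H = Suc ` {..<6}"
    by (auto simp: assms(2) lessThan_def numeral_eq_Suc less_Suc_eq)
  have "bij_betw (\<lambda>i. vs ! (i - 1)) (pverts H) (pverts G)"
  proof -
    have "bij_betw (\<lambda>i. i - 1) (Suc ` {..<6}) {..<6}" 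
      by (auto simp: bij_betw_def inj_on_def image_image)
    from bij_betw_trans[OF this bij_betw_nth[OF assms(4), of "{..<6}" "pverts G"]] show ?thesis
      using assms(3,5) by (simp add: V comp_def)
  qed
  moreover have "(i, j) \<in> parcs H \<longleftrightarrow> vs ! (i - 1) \<sim> vs ! (j - 1)" if "i \<in> pverts H" "j \<in> pverts H" for i j
  proof -
    have "i < j \<or> i = j \<or> j < i" by auto
    then show ?thesis
      using edge[of i j] edge[of j i] that adj_commute H.adj_commute by (auto simp: assms(2))
  qed
  ultimately show ?thesis
    using pair_wf_digraph_axioms H.pair_wf_digraph_axioms
    by (subst digraph_iso_with_proj_iff) auto
qed

lemma digraph_iso_H1I:
  assumes "distinct [v1, v2, v3, v4, v5, v6]" "pverts G = {v1, v2, v3, v4, v5, v6}"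
    and "v1 \<sim> v2" "v1 \<sim> v3" "v1 \<sim> v4" "v2 \<sim> v3" "v2 \<sim> v4" "v3 \<sim> v4"
      "v1 \<sim> v5" "v2 \<sim> v5" "v3 \<sim> v6" "v4 \<sim> v6" "v5 \<sim> v6"
    and "\<not> v1 \<sim> v6" "\<not> v2 \<sim> v6" "\<not> v3 \<sim> v5" "\<not> v4 \<sim> v5"
  shows "digraph_iso (with_proj G) (with_proj H1)"
proof (rule digraph_iso_listI[of _ "[v1, v2, v3, v4, v5, v6]"])
  fix i j :: nat assume "i \<in> {1, 2, 3, 4, 5, 6}" "j \<in> {1, 2, 3, 4, 5, 6}" "i < j"
  then show "(i, j) \<in> parcs H1 \<longleftrightarrow>
      [v1, v2, v3, v4, v5, v6] ! (i - 1) \<sim> [v1, v2, v3, v4, v5, v6] ! (j - 1)"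
    by (elim insertE emptyE; simp add: H1_def assms(3-))
qed (rule pair_graph_H1, use assms(1,2) in \<open>simp_all add: H1_def\<close>)

lemma digraph_iso_H2I:
  assumes "distinct [v1, v2, v3, v4, v5, v6]" "pverts G = {v1, v2, v3, v4, v5, v6}"
    and "v1 \<sim> v2" "v1 \<sim> v3" "v2 \<sim> v3" "v4 \<sim> v5" "v4 \<sim> v6" "v5 \<sim> v6"
      "v1 \<sim> v4" "v2 \<sim> v5" "v3 \<sim> v6"
    and "\<not> v1 \<sim> v5" "\<not> v1 \<sim> v6" "\<not> v2 \<sim> v4" "\<not> v2 \<sim> v6" "\<not> v3 \<sim> v4" "\<not> v3 \<sim> v5"
  shows "digraph_iso (with_proj G) (with_proj H2)"
proof (rule digraph_iso_listI[of _ "[v1, v2, v3, v4, v5, v6]"])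
  fix i j :: nat assume "i \<in> {1, 2, 3, 4, 5, 6}" "j \<in> {1, 2, 3, 4, 5, 6}" "i < j"
  then show "(i, j) \<in> parcs H2 \<longleftrightarrow>
      [v1, v2, v3, v4, v5, v6] ! (i - 1) \<sim> [v1, v2, v3, v4, v5, v6] ! (j - 1)"
    by (elim insertE emptyE; simp add: H2_def assms(3-))
qed (rule pair_graph_H2, use assms(1,2) in \<open>simp_all add: H2_def\<close>)

lemma digraph_iso_H3I:
  assumes "distinct [v1, v2, v3, v4, v5, v6]" "pverts G = {v1, v2, v3, v4, v5, v6}"
    and "v1 \<sim> v2" "v1 \<sim> v3" "v1 \<sim> v5" "v1 \<sim> v6" "v2 \<sim> v3" "v2 \<sim> v4" "v2 \<sim> v6"
      "v3 \<sim> v4" "v3 \<sim> v5" "v4 \<sim> v5" "v4 \<sim> v6" "v5 \<sim> v6"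
    and "\<not> v1 \<sim> v4" "\<not> v2 \<sim> v5" "\<not> v3 \<sim> v6"
  shows "digraph_iso (with_proj G) (with_proj H3)"
proof (rule digraph_iso_listI[of _ "[v1, v2, v3, v4, v5, v6]"])
  fix i j :: nat assume "i \<in> {1, 2, 3, 4, 5, 6}" "j \<in> {1, 2, 3, 4, 5, 6}" "i < j"
  then show "(i, j) \<in> parcs H3 \<longleftrightarrow>
      [v1, v2, v3, v4, v5, v6] ! (i - 1) \<sim> [v1, v2, v3, v4, v5, v6] ! (j - 1)"
    by (elim insertE emptyE; simp add: H3_edges assms(3-))
qed (rule pair_graph_H3, use assms(1,2) in \<open>simp_all add: H3_edges\<close>)

end

section \<open>Graphs of diameter two with two gaps at every vertex\<close>

text \<open>
The combinatorial content of 2-stress regularity. The arguments below count gaps: two known gaps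
at a vertex are all of its gaps, so every other pair of its neighbours is adjacent, and a third
gap is a contradiction.
\<close>

locale two_gap_graph = pair_graph +
  assumes diameter: diameter_le_2
    and two_gaps: "v \<in> pverts G \<Longrightarrow> card (gaps v) = 2"
begin

lemma gap_vertex: "gap v x y \<Longrightarrow> v \<in> pverts G"
  by (auto simp: gap_def dest: wellformed')

lemma third_gap:
  assumes "gap v x y" "gap v x' y'" "{x, y} \<noteq> {x', y'}" "gap v p q"
  shows "{p, q} = {x, y} \<or> {p, q} = {x', y'}"
proof (rule ccontr)
  assume "\<not> ?thesis"
  then have "card {{x, y}, {x', y'}, {p, q}} = 3"
    using assms(3) by (auto simp: card_insert_if)
  moreover have "{{x, y}, {x', y'}, {p, q}} \<subseteq> gaps v"
    using assms by (simp add: gap_in_gaps)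
  moreover have "card (gaps v) = 2"
    using assms(1) gap_vertex two_gaps by blast
  moreover from this have "finite (gaps v)"
    by (intro card_ge_0_finite) linarith
  ultimately show False
    using card_mono[of "gaps v" "{{x, y}, {x', y'}, {p, q}}"] by simp
qed

lemma ex_two_gaps:
  assumes "v \<in> pverts G"
  obtains x y x' y' where "gap v x y" "gap v x' y'" "{x, y} \<noteq> {x', y'}"
proof -
  obtain e e' where e: "gaps v = {e, e'}" "e \<noteq> e'"
    using two_gaps[OF assms] by (auto simp: card_2_iff)
  then have "e \<in> gaps v" "e' \<in> gaps v" by auto
  then obtain x y x' y' where "e = {x, y}" "gap v x y" "e' = {x', y'}" "gap v x' y'"
    unfolding gaps_def by auto
  then show ?thesis using e(2) that by blast
qed

lemma another_gap:
  assumes "v \<in> pverts G"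
  obtains x' y' where "gap v x' y'" "{x', y'} \<noteq> {x, y}"
  using ex_two_gaps[OF assms] by metis

text \<open>
A gap at a neighbour \<open>u\<close> of \<open>v\<close> which is not also a gap at \<open>v\<close> has an end that is at distance two
from \<open>v\<close>, and this end forms a gap at \<open>u\<close> together with \<open>v\<close>.
\<close>

lemma outer_gap:
  assumes "gap u x y" "u \<sim> v" "\<not> gap v x y"
  obtains z where "z \<in> {x, y}" "gap u v z"
proof (cases "v = x \<or> v \<sim> x")
  case True
  then have "gap u v y" using assms adj_sym by (auto simp: gap_def)
  then show ?thesis using that by blast
next
  case False
  then have "gap u v x" using assms by (auto simp: gap_def)
  then show ?thesis using that by blast
qed

lemma common_neighbour:
  assumes "u \<in> pverts G" "w \<in> pverts G" "u \<noteq> w" "\<not> u \<sim> w"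
  obtains x where "u \<sim> x" "x \<sim> w"
  using diameter assms unfolding diameter_le_2_def by blast

text \<open>
The vertex \<open>a\<close> sees the gap \<open>{c, d}\<close>. Its second gap is not a gap at \<open>v\<close>, so it is \<open>{v, s}\<close> for some
\<open>s\<close> at distance two from \<open>v\<close>, and all other neighbours of \<open>a\<close> except \<open>v\<close> are adjacent to \<open>s\<close>. A fifth
neighbour of \<open>v\<close> would be adjacent to \<open>a, b, c, d\<close> and \<open>s\<close> and would have the three gaps
\<open>{a, b}\<close>, \<open>{c, d}\<close>, \<open>{v, s}\<close>.
\<close>

lemma disjoint_gaps:
  assumes v: "gap v a b" "gap v c d" and dist: "distinct [a, b, c, d]"
  obtains s where "gap a v s" "s \<sim> c" "s \<sim> d"
    "\<And>x. v \<sim> x \<longleftrightarrow> x \<in> {a, b, c, d}" "\<And>x. a \<sim> x \<longleftrightarrow> x \<in> {v, c, d, s}"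
proof -
  have gap_v: "{x, y} = {a, b} \<or> {x, y} = {c, d}" if "gap v x y" for x y
    using third_gap[OF v _ that] dist by (auto simp: doubleton_eq_iff)
  have va: "v \<sim> a" "v \<sim> b" "v \<sim> c" "v \<sim> d" "\<not> a \<sim> b" "\<not> c \<sim> d"
    using v by (auto simp: gap_def)
  then have ne: "v \<noteq> a" "v \<noteq> b" "v \<noteq> c" "v \<noteq> d" by auto
  have near_v: "x \<sim> y" if "v \<sim> x" "v \<sim> y" "x \<noteq> y" "{x, y} \<noteq> {a, b}" "{x, y} \<noteq> {c, d}" for x y
    using gap_v[of x y] that by (auto simp: gap_def)
  have acd: "a \<sim> c" "a \<sim> d"
    using near_v[of a c] near_v[of a d] va dist by (auto simp: doubleton_eq_iff)
  then have a: "gap a c d" using va dist by (auto simp: gap_def)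
  obtain x y where xy: "gap a x y" "{x, y} \<noteq> {c, d}"
    using another_gap gap_vertex[OF a] by blast
  have "\<not> gap v x y" using gap_v[of x y] xy by (auto simp: gap_def doubleton_eq_iff)
  then obtain s where s: "gap a v s" using outer_gap xy(1) adj_sym va(1) by metis
  then have s': "a \<sim> s" "v \<noteq> s" "\<not> v \<sim> s" by (auto simp: gap_def)
  have gap_a: "{x, y} = {c, d} \<or> {x, y} = {v, s}" if "gap a x y" for x y
    using third_gap[OF a s _ that] ne by (auto simp: doubleton_eq_iff)
  have near_s: "z \<sim> s" if "a \<sim> z" "z \<noteq> v" "z \<noteq> s" for z
    using gap_a[of z s] that s' va ne by (auto simp: gap_def doubleton_eq_iff)
  have Nv: "v \<sim> f \<longleftrightarrow> f \<in> {a, b, c, d}" for f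
  proof
    assume f: "v \<sim> f"
    show "f \<in> {a, b, c, d}"
    proof (rule ccontr)
      assume n: "f \<notin> {a, b, c, d}"
      have fa: "f \<sim> a" "f \<sim> b" "f \<sim> c" "f \<sim> d"
        using near_v[of f] f va n by (auto simp: doubleton_eq_iff)
      have "f \<noteq> v" "f \<noteq> s" using f s' by auto
      then have "f \<sim> s" using near_s fa adj_sym by blast
      then have "gap f v s" "gap f a b" "gap f c d"
        using fa f s' va dist adj_sym by (auto simp: gap_def)
      from third_gap[OF this(2,3) _ this(1)] show False
        using ne dist by (auto simp: doubleton_eq_iff)
    qed
  qed (use va in auto)
  have Na: "a \<sim> z \<longleftrightarrow> z \<in> {v, c, d, s}" for z
  proof
    assume z: "a \<sim> z"
    show "z \<in> {v, c, d, s}"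
    proof (rule ccontr)
      assume n: "z \<notin> {v, c, d, s}"
      then have "gap a v z" using z Nv[of z] va adj_sym by (auto simp: gap_def)
      from gap_a[OF this] show False using n ne by (auto simp: doubleton_eq_iff)
    qed
  qed (use va acd s' adj_sym in auto)
  show ?thesis
    by (rule that[OF s _ _ Nv Na]) (use near_s[of c] near_s[of d] acd ne s' va adj_sym in auto)
qed

lemma within_two_steps:
  assumes "v \<in> pverts G" "x \<in> pverts G"
  shows "x = v \<or> v \<sim> x \<or> (\<exists>y. v \<sim> y \<and> y \<sim> x)"
  using common_neighbour[of v x] assms by metis

text \<open>
The vertices \<open>s\<close> that \<open>disjoint_gaps\<close> yields for \<open>a, b, c, d\<close> coincide, because \<open>s\<close> for \<open>a\<close> is a
neighbour of \<open>c\<close> and \<open>d\<close>, and so on. The non-adjacent pairs are then \<open>{v, s}, {a, b}, {c, d}\<close>.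
\<close>

lemma disjoint_gaps_imp_H3:
  assumes v: "gap v a b" "gap v c d" and dist: "distinct [a, b, c, d]"
  shows "digraph_iso (with_proj G) (with_proj H3)"
proof -
  obtain s where s: "gap a v s" "s \<sim> c" "s \<sim> d"
    and Nv: "\<And>x. v \<sim> x \<longleftrightarrow> x \<in> {a, b, c, d}" and Na: "\<And>x. a \<sim> x \<longleftrightarrow> x \<in> {v, c, d, s}"
    using disjoint_gaps[OF v dist] by blast
  have v': "gap v b a" "gap v d c" using v gap_commute by simp_all
  have dist': "distinct [c, d, a, b]" "distinct [b, a, c, d]" "distinct [d, c, a, b]"
    using dist by auto
  have sv: "\<not> v \<sim> s" "s \<noteq> v" using s by (auto simp: gap_def)
  then have s_ne: "s \<notin> {a, b, c, d}" using Nv by blast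
  obtain s' where s': "s' \<sim> b" and Nc: "\<And>x. c \<sim> x \<longleftrightarrow> x \<in> {v, a, b, s'}"
    using disjoint_gaps[OF v(2,1) dist'(1)] by metis
  have "s' = s" using Nc[of s] s(2) s_ne sv adj_sym by blast
  obtain s'' where Nb: "\<And>x. b \<sim> x \<longleftrightarrow> x \<in> {v, c, d, s''}"
    using disjoint_gaps[OF v'(1) v(2) dist'(2)] by metis
  have "s'' = s" using Nb[of s] s' \<open>s' = s\<close> s_ne sv adj_sym by blast
  obtain s3 where Nd: "\<And>x. d \<sim> x \<longleftrightarrow> x \<in> {v, a, b, s3}"
    using disjoint_gaps[OF v'(2) v(1) dist'(3)] by metis
  have "s3 = s" using Nd[of s] s(3) s_ne sv adj_sym by blast
  note N = Nv Na Nb[unfolded \<open>s'' = s\<close>] Nc[unfolded \<open>s' = s\<close>] Nd[unfolded \<open>s3 = s\<close>]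
  have ne: "distinct [v, a, c, s, b, d]"
    using dist s_ne sv Nv[of v] by auto
  have V: "pverts G = {v, a, c, s, b, d}"
  proof
    show "pverts G \<subseteq> {v, a, c, s, b, d}"
    proof
      fix x assume "x \<in> pverts G"
      from within_two_steps[OF gap_vertex[OF v(1)] this] show "x \<in> {v, a, c, s, b, d}"
        by (auto simp: N)
    qed
    have "v \<sim> a" "v \<sim> b" "v \<sim> c" "v \<sim> d" "a \<sim> s" by (simp_all add: N)
    then show "{v, a, c, s, b, d} \<subseteq> pverts G"
      by (simp add: in_arcsD1 in_arcsD2)
  qed
  show ?thesis
    by (rule digraph_iso_H3I[OF ne V]) (use ne s' \<open>s' = s\<close> s(2,3) in \<open>auto simp: N\<close>)
qed

end

section \<open>The case of two gaps with a common vertex\<close>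

text \<open>
The other possible shape of the two gaps at a vertex \<open>v\<close>: they share a vertex \<open>a\<close>. The situation is
symmetric in \<open>b\<close> and \<open>c\<close>, which the lemma \<open>swap\<close> makes available.
\<close>

locale shared_gaps = two_gap_graph +
  fixes v a b c :: 'a
  assumes gap_ab: "gap v a b" and gap_ac: "gap v a c" and b_neq_c: "b \<noteq> c"
begin

lemma base_adj:
  "v \<sim> a" "v \<sim> b" "v \<sim> c" "a \<sim> v" "b \<sim> v" "c \<sim> v"
  "\<not> a \<sim> b" "\<not> a \<sim> c" "\<not> b \<sim> a" "\<not> c \<sim> a"
  using gap_ab gap_ac adj_sym by (auto simp: gap_def)

lemma base_distinct: "distinct [v, a, b, c]"
  using gap_ab gap_ac b_neq_c by (auto simp: gap_def)

lemma gap_v: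
  assumes "gap v x y"
  shows "{x, y} = {a, b} \<or> {x, y} = {a, c}"
  using third_gap[OF gap_ab gap_ac _ assms] b_neq_c by (auto simp: doubleton_eq_iff)

lemma adj_within_nbrs:
  assumes "v \<sim> x" "v \<sim> y" "x \<noteq> y" "a \<notin> {x, y}"
  shows "x \<sim> y"
  using gap_v[of x y] assms by (auto simp: gap_def)

lemma b_adj_c: "b \<sim> c" "c \<sim> b"
  using adj_within_nbrs base_adj base_distinct by auto

lemma full_nbr_adj:
  assumes "v \<sim> f" "f \<notin> {a, b, c}" "v \<sim> x" "x \<noteq> f"
  shows "f \<sim> x"
  using gap_v[of f x] assms by (auto simp: gap_def doubleton_eq_iff)

text \<open>
A neighbour \<open>f\<close> of \<open>v\<close> outside both gaps is adjacent to all other neighbours of \<open>v\<close> and so inherits the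
gaps \<open>{a, b}\<close> and \<open>{a, c}\<close>. A neighbour \<open>z\<close> at distance two from \<open>v\<close> would add the gap \<open>{v, z}\<close>.
\<close>

lemma full_nbr_closed:
  assumes f: "v \<sim> f" "f \<notin> {a, b, c}" and "f \<sim> z" "z \<noteq> v"
  shows "v \<sim> z"
proof (rule ccontr)
  assume "\<not> v \<sim> z"
  then have "gap f v z" "gap f a b" "gap f a c"
    using assms full_nbr_adj[OF f] base_adj base_distinct adj_sym by (auto simp: gap_def)
  from third_gap[OF this(2,3) _ this(1)] show False
    using base_distinct by (auto simp: doubleton_eq_iff)
qed

text \<open>
Both gaps at \<open>v\<close> contain \<open>a\<close>, so no gap at \<open>a\<close> is a gap at \<open>v\<close>; the same holds at \<open>b\<close>, which is not
adjacent to \<open>a\<close> and not an end of \<open>{a, c}\<close>.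
\<close>

lemma outer_gap_a:
  obtains s where "gap a v s"
proof -
  obtain x y where xy: "gap a x y" using ex_two_gaps in_arcsD2[OF base_adj(1)] by blast
  have "\<not> gap v x y"
  proof
    assume "gap v x y"
    from gap_v[OF this] show False using xy base_adj by (auto simp: gap_def doubleton_eq_iff)
  qed
  then show ?thesis using outer_gap[OF xy base_adj(4)] that by blast
qed

lemma outer_gap_b:
  obtains t where "gap b v t"
proof -
  obtain x y where xy: "gap b x y" using ex_two_gaps in_arcsD2[OF base_adj(2)] by blast
  have "\<not> gap v x y"
  proof
    assume "gap v x y"
    from gap_v[OF this] show False using xy base_adj by (auto simp: gap_def doubleton_eq_iff)
  qed
  then show ?thesis using outer_gap[OF xy base_adj(5)] that by blast
qed

lemma swap: "shared_gaps G v a c b"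
  using gap_ab gap_ac b_neq_c by unfold_locales auto

text \<open>
With \<open>f\<close> present, each neighbour \<open>s\<close> of \<open>a\<close> at distance two from \<open>v\<close> costs the two gaps \<open>{v, s}\<close> and
\<open>{f, s}\<close>. Hence there is just one such \<open>s\<close> and no further gap; the same holds at \<open>b\<close>.
\<close>

lemma nbrs_a_full:
  assumes f: "v \<sim> f" "f \<notin> {a, b, c}"
  obtains s where "gap a v s" "\<And>x. a \<sim> x \<longleftrightarrow> x \<in> {v, f, s}"
proof -
  obtain s where s: "gap a v s" using outer_gap_a .
  then have s': "a \<sim> s" "s \<noteq> v" "\<not> v \<sim> s" by (auto simp: gap_def)
  have "f \<noteq> v" "f \<noteq> s" using f s' by auto
  have af: "a \<sim> f" using full_nbr_adj[OF f base_adj(1)] f adj_sym by auto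
  have fs: "\<not> f \<sim> s" using full_nbr_closed[OF f] s' by blast
  then have gfs: "gap a f s" using af s' \<open>f \<noteq> s\<close> by (auto simp: gap_def)
  have gap_a: "{x, y} = {v, s} \<or> {x, y} = {f, s}" if "gap a x y" for x y
    using third_gap[OF s gfs _ that] \<open>f \<noteq> v\<close> s' by (auto simp: doubleton_eq_iff)
  have "z \<in> {v, f, s}" if z: "a \<sim> z" for z
  proof (rule ccontr)
    assume n: "z \<notin> {v, f, s}"
    then have vz: "v \<sim> z" and zs: "z \<sim> s"
      using gap_a[of v z] gap_a[of z s] z s' base_adj(4)
      by (auto simp: gap_def doubleton_eq_iff)
    have "z \<notin> {a, b, c}" using z base_adj by auto
    from full_nbr_closed[OF vz this zs] s' show False by blast
  qed
  then have "a \<sim> x \<longleftrightarrow> x \<in> {v, f, s}" for x using base_adj(4) af s' by blast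
  with s show ?thesis by (rule that)
qed

lemma nbrs_b_full:
  assumes f: "v \<sim> f" "f \<notin> {a, b, c}"
  obtains t where "gap b v t" "c \<sim> t" "\<And>x. b \<sim> x \<longleftrightarrow> x \<in> {v, f, c, t}"
proof -
  obtain t where t: "gap b v t" using outer_gap_b .
  then have t': "b \<sim> t" "t \<noteq> v" "\<not> v \<sim> t" by (auto simp: gap_def)
  have ne: "f \<noteq> v" "f \<noteq> t" "c \<noteq> t" using f t' base_adj by auto
  have bf: "b \<sim> f" using full_nbr_adj[OF f base_adj(2)] f adj_sym by auto
  have ft: "\<not> f \<sim> t" using full_nbr_closed[OF f] t' by blast
  then have gft: "gap b f t" using bf t' ne by (auto simp: gap_def)
  have gap_b: "{x, y} = {v, t} \<or> {x, y} = {f, t}" if "gap b x y" for x y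
    using third_gap[OF t gft _ that] ne t' by (auto simp: doubleton_eq_iff)
  have ct: "c \<sim> t"
    using gap_b[of c t] b_adj_c t' ne f base_distinct by (auto simp: gap_def doubleton_eq_iff)
  have "z \<in> {v, f, c, t}" if z: "b \<sim> z" for z
  proof (rule ccontr)
    assume n: "z \<notin> {v, f, c, t}"
    then have vz: "v \<sim> z" and zt: "z \<sim> t"
      using gap_b[of v z] gap_b[of z t] z t' base_adj(5)
      by (auto simp: gap_def doubleton_eq_iff)
    have "z \<notin> {a, b, c}" using z n base_adj by auto
    from full_nbr_closed[OF vz this zt] t' show False by blast
  qed
  then have "b \<sim> x \<longleftrightarrow> x \<in> {v, f, c, t}" for x using base_adj(5) bf t' b_adj_c by blast
  with t ct show ?thesis by (rule that)
qed

text \<open>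
By \<open>nbrs_a_full\<close> and \<open>nbrs_b_full\<close>, the vertices \<open>v, f, b, c\<close> form a complete graph, \<open>a\<close> is adjacent
to \<open>v, f, s\<close>, and \<open>b\<close> and \<open>c\<close> are adjacent to a common vertex \<open>t\<close> at distance two from \<open>v\<close>.
If \<open>s\<close> and \<open>t\<close> were distinct, then \<open>s\<close> would have no neighbours besides \<open>a\<close> and \<open>t\<close> and thus at most
one gap. With \<open>s = t\<close> the graph is the first of the three.
\<close>

lemma full_nbr_imp_H1:
  assumes f: "v \<sim> f" "f \<notin> {a, b, c}"
  shows "digraph_iso (with_proj G) (with_proj H1)"
proof -
  interpret swap: shared_gaps G v a c b by (rule swap)
  obtain s where s: "gap a v s" and Na: "\<And>x. a \<sim> x \<longleftrightarrow> x \<in> {v, f, s}"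
    using nbrs_a_full[OF f] by metis
  obtain t where t: "gap b v t" "c \<sim> t" and Nb: "\<And>x. b \<sim> x \<longleftrightarrow> x \<in> {v, f, c, t}"
    using nbrs_b_full[OF f] by metis
  have f': "f \<notin> {a, c, b}" using f by auto
  obtain t' where Nc': "\<And>x. c \<sim> x \<longleftrightarrow> x \<in> {v, f, b, t'}"
    using swap.nbrs_b_full[OF f(1) f'] by metis
  have st: "\<not> v \<sim> s" "s \<noteq> v" "\<not> v \<sim> t" "t \<noteq> v" using s t by (auto simp: gap_def)
  have "t' = t" using Nc'[of t] t(2) st f base_adj by auto
  note Nc = Nc'[unfolded this]
  have Nv: "v \<sim> x \<longleftrightarrow> x \<in> {f, a, b, c}" for x
    using full_nbr_adj[of x a] base_adj(1-3) adj_sym[of x a] Na[of x] f st by auto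
  have Nf: "f \<sim> x \<longleftrightarrow> x \<in> {v, a, b, c}" for x
    using full_nbr_closed[OF f, of x] full_nbr_adj[OF f, of x] Nv[of x] f adj_sym[OF f(1)] base_adj(1-3)
    by auto
  note N = Nv Nf Na Nb Nc
  have V: "x \<in> {v, f, a, b, c, s, t}" if "x \<in> pverts G" for x
    using within_two_steps[OF in_arcsD1[OF f(1)] that] by (auto simp: N)
  have "s = t"
  proof (rule ccontr)
    assume ne: "s \<noteq> t"
    have "z \<in> {a, t}" if "s \<sim> z" for z
    proof -
      have "z \<in> {v, f, a, b, c, s, t}" using V that in_arcsD2 by blast
      moreover have "\<not> z \<sim> s" if "z \<in> {v, f, b, c, s}"
        using that ne st f base_adj by (auto simp: N)
      ultimately show ?thesis using adj_sym[OF that] by blast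
    qed
    then have "gap s x y \<Longrightarrow> {x, y} = {a, t}" for x y by (auto simp: gap_def)
    moreover have "s \<in> pverts G" using Na[of s] in_arcsD2 by blast
    ultimately show False using ex_two_gaps by metis
  qed
  have dist: "distinct [v, f, b, c, a, s]"
    using f st base_distinct base_adj by auto
  have V': "pverts G = {v, f, b, c, a, s}"
  proof
    show "pverts G \<subseteq> {v, f, b, c, a, s}" using V \<open>s = t\<close> by auto
    have "v \<sim> f" "v \<sim> a" "v \<sim> b" "v \<sim> c" "a \<sim> s" by (simp_all add: N)
    then show "{v, f, b, c, a, s} \<subseteq> pverts G" by (simp add: in_arcsD1 in_arcsD2)
  qed
  show ?thesis
    by (rule digraph_iso_H1I[OF dist V']) (use dist \<open>s = t\<close> in \<open>auto simp: N\<close>)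
qed

text \<open>
Now \<open>v\<close> has the three neighbours \<open>a, b, c\<close> only. Every neighbour \<open>z\<close> of \<open>a\<close> other than \<open>v\<close> gives the gap
\<open>{v, z}\<close> at \<open>a\<close>. There are two such neighbours: three would give three gaps, and a single one would
leave no second gap. As these gaps are all, the two neighbours are adjacent.
\<close>

lemma nbrs_a:
  assumes Nv: "\<And>x. v \<sim> x \<longleftrightarrow> x \<in> {a, b, c}"
  obtains s1 s2 where "gap a v s1" "gap a v s2" "s1 \<noteq> s2" "s1 \<sim> s2"
    "\<And>x. a \<sim> x \<longleftrightarrow> x \<in> {v, s1, s2}"
proof -
  obtain s1 where s1: "gap a v s1" using outer_gap_a .
  have outer: "gap a v z" if "a \<sim> z" "z \<noteq> v" for z
    using that Nv[of z] base_adj by (auto simp: gap_def)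
  obtain x y where xy: "gap a x y" "{x, y} \<noteq> {v, s1}"
    using another_gap in_arcsD2[OF base_adj(1)] by metis
  obtain s2 where s2: "gap a v s2" "s2 \<noteq> s1"
  proof (cases "v = x \<or> v = y")
    case True
    then show ?thesis using that xy gap_commute[of a x y] by (metis doubleton_eq_iff)
  next
    case False
    then have "gap a v x" "gap a v y" using outer xy(1) by (auto simp: gap_def)
    moreover have "x \<noteq> y" using xy(1) by (auto simp: gap_def)
    ultimately show ?thesis using that[of x] that[of y] by metis
  qed
  have ne: "s1 \<noteq> v" "s2 \<noteq> v" using s1 s2 by (auto simp: gap_def)
  have gap_a: "{x, y} = {v, s1} \<or> {x, y} = {v, s2}" if "gap a x y" for x y
    using third_gap[OF s1 s2(1) _ that] s2(2) ne by (auto simp: doubleton_eq_iff)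
  have "s1 \<sim> s2"
    using gap_a[of s1 s2] s1 s2 by (auto simp: gap_def doubleton_eq_iff)
  moreover have "a \<sim> x \<longleftrightarrow> x \<in> {v, s1, s2}" for x
    using gap_a[OF outer, of x] s1 s2 by (auto simp: gap_def doubleton_eq_iff)
  ultimately show ?thesis using that[OF s1 s2(1) s2(2)[symmetric]] by blast
qed

text \<open>
Besides \<open>v\<close> and \<open>c\<close>, the vertex \<open>b\<close> has one or two neighbours, each of which forms a gap at \<open>b\<close>
with \<open>v\<close>. If there is one, the second gap consists of it and \<open>c\<close>; if there are two, the gaps are
used up and \<open>c\<close> is adjacent to both.
\<close>

lemma nbrs_b [consumes 1, case_names one two]:
  assumes Nv: "\<And>x. v \<sim> x \<longleftrightarrow> x \<in> {a, b, c}"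
  obtains
    (one) t where "gap b v t" "\<not> c \<sim> t" "\<And>x. b \<sim> x \<longleftrightarrow> x \<in> {v, c, t}"
  | (two) t1 t2 where "gap b v t1" "gap b v t2" "t1 \<noteq> t2" "t1 \<sim> t2" "c \<sim> t1" "c \<sim> t2"
      "\<And>x. b \<sim> x \<longleftrightarrow> x \<in> {v, c, t1, t2}"
proof -
  obtain t where t: "gap b v t" using outer_gap_b .
  have outer: "gap b v z" if "b \<sim> z" "z \<noteq> v" "z \<noteq> c" for z
    using that Nv[of z] base_adj by (auto simp: gap_def)
  have inner: "z \<noteq> v" "z \<noteq> c" if "gap b v z" for z
    using that base_adj by (auto simp: gap_def)
  show ?thesis
  proof (cases "\<exists>t'. gap b v t' \<and> t' \<noteq> t")
    case True
    then obtain t' where t': "gap b v t'" "t' \<noteq> t" by blast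
    have gap_b: "{x, y} = {v, t} \<or> {x, y} = {v, t'}" if "gap b x y" for x y
      using third_gap[OF t t'(1) _ that] t' inner[OF t] by (auto simp: doubleton_eq_iff)
    have "t \<sim> t'" "c \<sim> t" "c \<sim> t'"
      using gap_b[of t t'] gap_b[of c t] gap_b[of c t'] t t' inner[OF t] inner[OF t'(1)]
        b_adj_c base_distinct
      by (auto simp: gap_def doubleton_eq_iff)
    moreover have "b \<sim> x \<longleftrightarrow> x \<in> {v, c, t, t'}" for x
      using gap_b[OF outer, of x] t t' b_adj_c by (auto simp: gap_def doubleton_eq_iff)
    ultimately show ?thesis using two[OF t t'(1) t'(2)[symmetric]] by blast
  next
    case False
    then have uniq: "z = t" if "b \<sim> z" "z \<noteq> v" "z \<noteq> c" for z using outer that by blast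
    obtain x y where xy: "gap b x y" "{x, y} \<noteq> {v, t}"
      using another_gap in_arcsD2[OF base_adj(2)] by metis
    have "x \<noteq> v" "y \<noteq> v" using xy gap_commute False by blast+
    then have "{x, y} = {c, t}"
      using xy(1) uniq[of x] uniq[of y] by (auto simp: gap_def)
    then have "\<not> c \<sim> t" using xy(1) adj_sym by (auto simp: gap_def doubleton_eq_iff)
    moreover have "b \<sim> x \<longleftrightarrow> x \<in> {v, c, t}" for x
      using uniq[of x] t b_adj_c base_adj by (auto simp: gap_def)
    ultimately show ?thesis using one[OF t] by blast
  qed
qed

text \<open>
If some \<open>s\<^sub>i\<close> is also a \<open>t\<^sub>j\<close>, then \<open>{a, b}\<close> and \<open>{a, c}\<close> are its gaps, so it passes its adjacency to \<open>b\<close>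
on to the other \<open>s\<close>, and the two sets coincide. If the sets are disjoint, every \<open>s\<^sub>i\<close> is adjacent to
some \<open>t\<^sub>j\<close> since its distance from \<open>b\<close> is two; counting gaps at \<open>t\<^sub>j\<close> shows that it is then adjacent to
both, which gives \<open>t\<^sub>1\<close> the gaps \<open>{b, s\<^sub>1}\<close>, \<open>{c, s\<^sub>1}\<close>, \<open>{b, s\<^sub>2}\<close>.
\<close>

lemma common_outer_nbrs_imp_H1:
  assumes Nv: "\<And>x. v \<sim> x \<longleftrightarrow> x \<in> {a, b, c}"
    and Na: "\<And>x. a \<sim> x \<longleftrightarrow> x \<in> {v, s1, s2}"
    and Nb: "\<And>x. b \<sim> x \<longleftrightarrow> x \<in> {v, c, t1, t2}"
    and Nc: "\<And>x. c \<sim> x \<longleftrightarrow> x \<in> {v, b, t1, t2}"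
    and s: "gap a v s1" "gap a v s2" "s1 \<noteq> s2" "s1 \<sim> s2"
    and t: "gap b v t1" "gap b v t2" "t1 \<noteq> t2" "t1 \<sim> t2"
  shows "digraph_iso (with_proj G) (with_proj H1)"
proof -
  note N = Nv Na Nb Nc
  have out: "\<not> v \<sim> s1" "\<not> v \<sim> s2" "\<not> v \<sim> t1" "\<not> v \<sim> t2"
      "s1 \<noteq> v" "s2 \<noteq> v" "t1 \<noteq> v" "t2 \<noteq> v"
    using s t by (auto simp: gap_def)
  then have ne: "s1 \<notin> {a, b, c}" "s2 \<notin> {a, b, c}" "t1 \<notin> {a, b, c}" "t2 \<notin> {a, b, c}"
    using Nv by blast+
  \<comment> \<open>A vertex \<open>x\<close> in both sets has the gaps \<open>{a, b}\<close> and \<open>{a, c}\<close>, so \<open>{b, z}\<close> is no gap at \<open>x\<close>.\<close>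
  have spread: "z \<in> {t1, t2}" if "x \<in> {s1, s2}" "x \<in> {t1, t2}" "x \<sim> z" "z \<in> {s1, s2}" for x z
  proof (rule ccontr)
    assume z: "z \<notin> {t1, t2}"
    have "a \<sim> x" "b \<sim> x" "c \<sim> x" using that by (auto simp: N)
    then have "gap x a b" "gap x a c" using base_adj base_distinct adj_sym by (auto simp: gap_def)
    moreover have "gap x b z"
      using z that ne \<open>b \<sim> x\<close> adj_sym out by (auto simp: gap_def Nb)
    moreover have "z \<noteq> a" "z \<noteq> b" using that ne by auto
    ultimately show False
      using third_gap[of x a b a c b z] base_distinct by (auto simp: doubleton_eq_iff)
  qed
  have "{s1, s2} = {t1, t2}"
  proof (cases "s1 \<in> {t1, t2} \<or> s2 \<in> {t1, t2}")
    case True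
    then have "s1 \<in> {t1, t2}" "s2 \<in> {t1, t2}"
      using spread[of s1 s2] spread[of s2 s1] s(4) adj_sym by auto
    then show ?thesis using s(3) by auto
  next
    case False
    have nbs: "\<not> b \<sim> x" "\<not> c \<sim> x" "x \<noteq> b" "x \<noteq> c" if "x \<in> {s1, s2}" for x
      using that False out ne by (auto simp: N)
    have tg: "gap y b x" "gap y c x" if "x \<in> {s1, s2}" "y \<in> {t1, t2}" "y \<sim> x" for x y
    proof -
      have "b \<sim> y" "c \<sim> y" using that by (auto simp: N)
      then show "gap y b x" "gap y c x"
        using nbs[OF that(1)] that(3) adj_sym by (auto simp: gap_def)
    qed
    \<comment> \<open>Otherwise \<open>y\<close> has the gaps \<open>{b, x}\<close>, \<open>{c, x}\<close> and \<open>{y', x}\<close>.\<close>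
    have both: "y' \<sim> x" if "x \<in> {s1, s2}" "y \<in> {t1, t2}" "y' \<in> {t1, t2}" "y \<sim> x" "y \<sim> y'" for x y y'
    proof (rule ccontr)
      assume "\<not> y' \<sim> x"
      then have "gap y y' x" using that False by (auto simp: gap_def)
      moreover have "y' \<noteq> b" "y' \<noteq> c" "x \<noteq> b" using that ne by auto
      ultimately show False
        using third_gap[OF tg[OF that(1,2,4)], of y' x] b_neq_c by (auto simp: doubleton_eq_iff)
    qed
    have all: "t1 \<sim> x" if x: "x \<in> {s1, s2}" for x
    proof -
      have "b \<in> pverts G" "x \<in> pverts G"
        using x in_arcsD2[OF base_adj(2)] s by (auto simp: gap_def dest: in_arcsD2)
      then obtain y where "b \<sim> y" "y \<sim> x" using common_neighbour nbs[OF x] by metis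
      then have "y \<in> {t1, t2}" using nbs[OF x] x out by (auto simp: Nb)
      then show ?thesis
        using both[OF x _ _ \<open>y \<sim> x\<close>, of t1] \<open>y \<sim> x\<close> t(4) adj_sym by auto
    qed
    have "gap t1 b s1" "gap t1 c s1" "gap t1 b s2"
      using tg all by auto
    from third_gap[OF this(1,2) _ this(3)] show ?thesis
      using s(3) ne b_neq_c by (auto simp: doubleton_eq_iff)
  qed
  then have bcs: "b \<sim> s1" "b \<sim> s2" "c \<sim> s1" "c \<sim> s2" by (auto simp: N)
  \<comment> \<open>The complete graph on \<open>b, c, s\<^sub>1, s\<^sub>2\<close> together with the edge \<open>va\<close>.\<close>
  have dist: "distinct [b, c, s1, s2, v, a]"
    using base_distinct ne out s(3) by auto
  have V: "pverts G = {b, c, s1, s2, v, a}"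
  proof
    show "pverts G \<subseteq> {b, c, s1, s2, v, a}"
    proof
      fix x assume "x \<in> pverts G"
      from within_two_steps[OF in_arcsD1[OF base_adj(1)] this] show "x \<in> {b, c, s1, s2, v, a}"
        using \<open>{s1, s2} = {t1, t2}\<close> by (auto simp: N doubleton_eq_iff)
    qed
    show "{b, c, s1, s2, v, a} \<subseteq> pverts G"
      using bcs base_adj in_arcsD1 in_arcsD2 by blast
  qed
  have "\<not> s1 \<sim> v" "\<not> s2 \<sim> v" "s1 \<sim> a" "s2 \<sim> a"
    using out s adj_sym by (auto simp: gap_def)
  then show ?thesis
    using digraph_iso_H1I[OF dist V] bcs base_adj b_adj_c s(4) by blast
qed

text \<open>
The triangles \<open>v, b, c\<close> and \<open>a, u, w\<close> are joined by \<open>va\<close> and \<open>cu\<close>; the remaining outer neighbour \<open>t\<close> of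
\<open>b\<close> has to be \<open>w\<close>. Otherwise the neighbours of \<open>t\<close> lie among \<open>b, u, w\<close>, and \<open>t\<close> needs \<open>u\<close> in order to have
two gaps. But then \<open>u\<close> has the gaps \<open>{a, c}\<close>, \<open>{c, w}\<close>, \<open>{c, t}\<close>.
\<close>

lemma third_prism_rung:
  assumes Nv: "\<And>x. v \<sim> x \<longleftrightarrow> x \<in> {a, b, c}"
    and Na: "\<And>x. a \<sim> x \<longleftrightarrow> x \<in> {v, u, w}"
    and Nb: "\<And>x. b \<sim> x \<longleftrightarrow> x \<in> {v, c, t}"
    and Nc: "\<And>x. c \<sim> x \<longleftrightarrow> x \<in> {v, b, u}"
    and "u \<noteq> w" "u \<sim> w" "gap b v t" "gap a v w" "\<not> c \<sim> t"
  shows "t = w"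
proof (rule ccontr)
  assume tw: "t \<noteq> w"
  note N = Nv Na Nb Nc
  have out: "\<not> v \<sim> t" "t \<noteq> v" "\<not> v \<sim> w" "w \<noteq> v" using assms(7,8) by (auto simp: gap_def)
  have ne: "t \<notin> {a, b, c}" "w \<notin> {a, b, c}" using out Nv by blast+
  have ut: "t \<noteq> u" using assms(9) Nc by blast
  have at: "\<not> a \<sim> t" "\<not> c \<sim> w" using out tw ut ne assms(5) by (auto simp: N)
  have Nt: "z \<in> {b, u, w}" if "t \<sim> z" for z
  proof -
    have "z \<in> {v, a, b, c, u, w, t}"
      using within_two_steps[OF in_arcsD1[OF base_adj(1)] in_arcsD2[OF that]] by (auto simp: N)
    then show ?thesis using that at out assms(9) adj_sym by auto
  qed
  have "t \<sim> u"
  proof (rule ccontr)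
    assume "\<not> t \<sim> u"
    then have "{x, y} = {b, w}" if "gap t x y" for x y
      using that Nt[of x] Nt[of y] by (auto simp: gap_def)
    moreover have "t \<in> pverts G" using assms(7) in_arcsD2 by (auto simp: gap_def)
    ultimately show False using ex_two_gaps by metis
  qed
  moreover have "a \<sim> u" "c \<sim> u" by (simp_all add: N)
  ultimately have "gap u a c" "gap u c w" "gap u c t"
    using base_adj base_distinct at assms(6,9) adj_sym ne by (auto simp: gap_def)
  from third_gap[OF this(1,2) _ this(3)] show False
    using tw ne by (auto simp: doubleton_eq_iff)
qed

text \<open>
By \<open>third_prism_rung\<close> and symmetry it suffices that \<open>t\<close> or \<open>u\<close> is a neighbour of \<open>a\<close>. If neither is,
then both \<open>s\<^sub>1\<close> and \<open>s\<^sub>2\<close> can reach \<open>b\<close> in two steps only through \<open>t\<close>, and \<open>c\<close> only through \<open>u\<close>. The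
gaps at \<open>s\<^sub>1\<close> force \<open>t\<close> and \<open>u\<close> to be adjacent, so \<open>t\<close> has the gaps \<open>{b, s\<^sub>1}\<close>, \<open>{b, s\<^sub>2}\<close>, \<open>{b, u}\<close>.
\<close>

lemma single_outer_nbrs_imp_H2:
  assumes Nv: "\<And>x. v \<sim> x \<longleftrightarrow> x \<in> {a, b, c}"
    and Na: "\<And>x. a \<sim> x \<longleftrightarrow> x \<in> {v, s1, s2}"
    and Nb: "\<And>x. b \<sim> x \<longleftrightarrow> x \<in> {v, c, t}"
    and Nc: "\<And>x. c \<sim> x \<longleftrightarrow> x \<in> {v, b, u}"
    and s: "gap a v s1" "gap a v s2" "s1 \<noteq> s2" "s1 \<sim> s2"
    and t: "gap b v t" "\<not> c \<sim> t" and u: "gap c v u" "\<not> b \<sim> u"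
  shows "digraph_iso (with_proj G) (with_proj H2)"
proof -
  interpret swap: shared_gaps G v a c b by (rule swap)
  note N = Nv Na Nb Nc
  have out: "\<not> v \<sim> s1" "\<not> v \<sim> s2" "\<not> v \<sim> t" "\<not> v \<sim> u"
      "s1 \<noteq> v" "s2 \<noteq> v" "t \<noteq> v" "u \<noteq> v"
    using s t u by (auto simp: gap_def)
  then have ne: "s1 \<notin> {a, b, c}" "s2 \<notin> {a, b, c}" "t \<notin> {a, b, c}" "u \<notin> {a, b, c}"
    using Nv by blast+
  have "t \<noteq> u" using t(2) Nc by blast
  have Nv': "v \<sim> x \<longleftrightarrow> x \<in> {a, c, b}" and Na': "a \<sim> x \<longleftrightarrow> x \<in> {v, s2, s1}" for x
    by (auto simp: N)
  have s21: "s2 \<noteq> s1" "s2 \<sim> s1" using s adj_sym by auto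
  have "t = s2" if "u = s1"
    using third_prism_rung[OF Nv Na Nb Nc[unfolded that] s(3,4) t(1) s(2) t(2)] .
  moreover have "t = s1" if "u = s2"
    using third_prism_rung[OF Nv Na' Nb Nc[unfolded that] s21 t(1) s(1) t(2)] .
  moreover have "u = s2" if "t = s1"
    using swap.third_prism_rung[OF Nv' Na Nc Nb[unfolded that] s(3,4) u(1) s(2) u(2)] .
  moreover have "u = s1" if "t = s2"
    using swap.third_prism_rung[OF Nv' Na' Nc Nb[unfolded that] s21 u(1) s(1) u(2)] .
  moreover have "t \<in> {s1, s2} \<or> u \<in> {s1, s2}"
  proof (rule ccontr)
    assume n: "\<not> ?thesis"
    have Vs: "b \<in> pverts G" "c \<in> pverts G" "s1 \<in> pverts G" "s2 \<in> pverts G"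
      using base_adj s by (auto simp: gap_def dest: in_arcsD2)
    have ts: "t \<sim> x" and us: "u \<sim> x" if x: "x \<in> {s1, s2}" for x
    proof -
      have nb: "\<not> b \<sim> x" "\<not> c \<sim> x" "b \<noteq> x" "c \<noteq> x" "x \<in> pverts G" "\<not> v \<sim> x"
        using x n out ne Vs by (auto simp: N)
      obtain y where "b \<sim> y" "y \<sim> x" using common_neighbour[OF Vs(1) nb(5,3,1)] .
      then show "t \<sim> x" using nb by (auto simp: Nb)
      obtain y where "c \<sim> y" "y \<sim> x" using common_neighbour[OF Vs(2) nb(5,4,2)] .
      then show "u \<sim> x" using nb by (auto simp: Nc)
    qed
    have nt: "\<not> a \<sim> t" "\<not> a \<sim> u" using n out by (auto simp: N)
    have "t \<sim> u"
    proof (rule ccontr)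
      assume "\<not> t \<sim> u"
      then have "gap s1 a t" "gap s1 a u" "gap s1 t u"
        using ts us s(1) nt adj_sym ne \<open>t \<noteq> u\<close> by (auto simp: gap_def)
      from third_gap[OF this(1,2) _ this(3)] show False
        using \<open>t \<noteq> u\<close> ne by (auto simp: doubleton_eq_iff)
    qed
    then have "gap t b s1" "gap t b s2" "gap t b u"
      using ts t(1) u(2) n ne out adj_sym by (auto simp: gap_def N)
    from third_gap[OF this(1,2) _ this(3)] show False
      using n s(3) ne by (auto simp: doubleton_eq_iff)
  qed
  ultimately have tu: "t = s1 \<and> u = s2 \<or> t = s2 \<and> u = s1" by blast
  then have adj: "a \<sim> t" "a \<sim> u" "t \<sim> u" using s(4) adj_sym by (auto simp: N)
  have dist: "distinct [v, b, c, a, t, u]"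
    using base_distinct ne out \<open>t \<noteq> u\<close> by auto
  have V: "pverts G = {v, b, c, a, t, u}"
  proof
    show "pverts G \<subseteq> {v, b, c, a, t, u}"
    proof
      fix x assume "x \<in> pverts G"
      from within_two_steps[OF in_arcsD1[OF base_adj(1)] this] show "x \<in> {v, b, c, a, t, u}"
        using tu by (auto simp: N)
    qed
    show "{v, b, c, a, t, u} \<subseteq> pverts G"
      using adj base_adj in_arcsD1 in_arcsD2 by blast
  qed
  have "b \<sim> t" "c \<sim> u" using t u by (auto simp: gap_def)
  then show ?thesis
    using digraph_iso_H2I[OF dist V] base_adj b_adj_c adj out t(2) u(2) by blast
qed

text \<open>
If \<open>v\<close> has no neighbours besides \<open>a, b, c\<close>, the alternatives of \<open>nbrs_b\<close> for \<open>b\<close> and for \<open>c\<close> must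
agree, because in the second alternative the outer neighbours of \<open>b\<close> and \<open>c\<close> are the same.
\<close>

lemma shared_gaps_imp_H1_or_H2:
  "digraph_iso (with_proj G) (with_proj H1) \<or> digraph_iso (with_proj G) (with_proj H2)"
proof (cases "\<exists>f. v \<sim> f \<and> f \<notin> {a, b, c}")
  case True
  then show ?thesis using full_nbr_imp_H1 by blast
next
  case False
  interpret swap: shared_gaps G v a c b by (rule swap)
  have Nv: "v \<sim> x \<longleftrightarrow> x \<in> {a, b, c}" and Nv': "v \<sim> x \<longleftrightarrow> x \<in> {a, c, b}" for x
    using False base_adj by blast+
  obtain s1 s2 where s: "gap a v s1" "gap a v s2" "s1 \<noteq> s2" "s1 \<sim> s2"
    and Na: "\<And>x. a \<sim> x \<longleftrightarrow> x \<in> {v, s1, s2}"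
    using nbrs_a[OF Nv] by metis
  show ?thesis
  using Nv
  proof (cases rule: nbrs_b)
    case b: (one t)
    show ?thesis
    using Nv'
    proof (cases rule: swap.nbrs_b)
      case c: (one u)
      show ?thesis
        using single_outer_nbrs_imp_H2[OF Nv Na b(3) c(3) s b(1,2) c(1,2)] ..
    next
      case c: (two u1 u2)
      have "u1 \<in> {v, c, t}" "u2 \<in> {v, c, t}" using c(5,6) b(3) by blast+
      then have False using c(1,2,3) base_adj by (auto simp: gap_def)
      then show ?thesis ..
    qed
  next
    case b: (two t1 t2)
    show ?thesis
    using Nv'
    proof (cases rule: swap.nbrs_b)
      case c: (one u)
      have "t1 \<in> {v, b, u}" "t2 \<in> {v, b, u}" using b(5,6) c(3) by blast+
      then have False using b(1,2,3) base_adj by (auto simp: gap_def)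
      then show ?thesis ..
    next
      case c: (two u1 u2)
      have "t1 \<in> {v, b, u1, u2}" "t2 \<in> {v, b, u1, u2}" using b(5,6) c(7) by blast+
      then have "{u1, u2} = {t1, t2}" using b(1,2,3) base_adj by (auto simp: gap_def)
      then have Nc: "c \<sim> x \<longleftrightarrow> x \<in> {v, b, t1, t2}" for x using c(7)[of x] by blast
      show ?thesis using common_outer_nbrs_imp_H1[OF Nv Na b(7) Nc s b(1-4)] ..
    qed
  qed
qed

end

section \<open>The characterisation\<close>

lemma (in two_gap_graph) classification:
  assumes "pverts G \<noteq> {}"
  shows "digraph_iso (with_proj G) (with_proj H1) \<or> digraph_iso (with_proj G) (with_proj H2) \<or>
    digraph_iso (with_proj G) (with_proj H3)"
proof -
  obtain v where "v \<in> pverts G" using assms by blast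
  then obtain a b c d where g: "gap v a b" "gap v c d" "{a, b} \<noteq> {c, d}"
    using ex_two_gaps by metis
  have ab: "a \<noteq> b" "c \<noteq> d" using g by (auto simp: gap_def)
  have shared: ?thesis if "gap v x y" "gap v x z" "y \<noteq> z" for x y z
  proof -
    interpret shared_gaps G v x y z using that by unfold_locales
    show ?thesis using shared_gaps_imp_H1_or_H2 by blast
  qed
  have g': "gap v b a" "gap v d c" using g gap_commute by blast+
  consider "distinct [a, b, c, d]" | "a = c" | "a = d" | "b = c" | "b = d" using ab by auto
  then show ?thesis
  proof cases
    case 1
    then show ?thesis using disjoint_gaps_imp_H3 g by blast
  next
    case 2
    then show ?thesis using shared[of a b d] g by auto
  next
    case 3
    then show ?thesis using shared[of a b c] g g' by auto
  next
    case 4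
    then show ?thesis using shared[of b a d] g g' by auto
  next
    case 5
    then show ?thesis using shared[of b a c] g g' by auto
  qed
qed

lemma two_gaps_transfer:
  assumes "pair_graph G" "pair_graph H"
    and f: "bij_betw f (pverts H) (pverts G)"
    and adj: "\<And>i j. i \<in> pverts H \<Longrightarrow> j \<in> pverts H \<Longrightarrow> (i, j) \<in> parcs H \<longleftrightarrow> (f i, f j) \<in> parcs G"
    and "two_gap_graph H"
  shows "two_gap_graph G"
proof -
  interpret G: pair_graph G by fact
  interpret H: two_gap_graph H by fact
  have V: "pverts G = f ` pverts H" and inj: "inj_on f (pverts H)"
    using f by (auto simp: bij_betw_def)
  show ?thesis
  proof
    show "G.diameter_le_2"
      unfolding G.diameter_le_2_def V
    proof (intro ballI impI; elim imageE)
      fix u w i j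
      assume ij: "i \<in> pverts H" "j \<in> pverts H" "u = f i" "w = f j" "u \<noteq> w" "(u, w) \<notin> parcs G"
      then obtain k where k: "(i, k) \<in> parcs H" "(k, j) \<in> parcs H"
        using H.common_neighbour[of i j] adj by metis
      then have "k \<in> pverts H" using H.in_arcsD2 by blast
      then show "\<exists>x. (u, x) \<in> parcs G \<and> (x, w) \<in> parcs G" using k ij adj by blast
    qed
    fix v assume "v \<in> pverts G"
    then obtain i where i: "i \<in> pverts H" "v = f i" by (auto simp: V)
    have gap: "G.gap v (f j) (f k) \<longleftrightarrow> H.gap i j k" if "j \<in> pverts H" "k \<in> pverts H" for j k
      using that i adj inj_on_eq_iff[OF inj] by (simp add: G.gap_def H.gap_def)
    have gap_in_H: "j \<in> pverts H \<and> k \<in> pverts H" if "H.gap i j k" for j k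
      using that H.in_arcsD2 by (auto simp: H.gap_def)
    have gap_in_G: "x \<in> f ` pverts H \<and> y \<in> f ` pverts H" if "G.gap v x y" for x y
      using that G.in_arcsD2 V by (auto simp: G.gap_def)
    have "G.gaps v = image f ` H.gaps i"
    proof (intro equalityI subsetI)
      fix e assume "e \<in> G.gaps v"
      then obtain x y where "e = {x, y}" "G.gap v x y" by (auto simp: G.gaps_def)
      moreover from this obtain j k where "x = f j" "y = f k" "j \<in> pverts H" "k \<in> pverts H"
        using gap_in_G by blast
      ultimately have "e = f ` {j, k}" "{j, k} \<in> H.gaps i"
        using gap by (auto simp: H.gap_in_gaps)
      then show "e \<in> image f ` H.gaps i" by blast
    next
      fix e assume "e \<in> image f ` H.gaps i"
      then obtain j k where "e = {f j, f k}" "H.gap i j k" by (auto simp: H.gaps_def)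
      then show "e \<in> G.gaps v" using gap gap_in_H by (auto simp: G.gap_in_gaps)
    qed
    moreover have "inj_on (image f) (H.gaps i)"
      using inj gap_in_H by (intro inj_on_subset[OF inj_on_image_Pow]) (auto simp: H.gaps_def)
    ultimately show "card (G.gaps v) = 2"
      using H.two_gaps[OF i(1)] by (simp add: card_image)
  qed
qed

lemma (in pair_graph) card_gaps_eq_2I:
  assumes "gap v p q" "gap v r s" "{p, q} \<noteq> {r, s}"
    and only: "\<forall>x\<in>pverts G. \<forall>y\<in>pverts G. gap v x y \<longrightarrow> {x, y} = {p, q} \<or> {x, y} = {r, s}"
  shows "card (gaps v) = 2"
proof -
  have "{x, y} \<in> {{p, q}, {r, s}}" if "gap v x y" for x y
    using that only in_arcsD2 unfolding gap_def by blast
  then have "gaps v = {{p, q}, {r, s}}"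
    unfolding gaps_def using assms(1,2) by blast
  then show ?thesis using assms(3) by simp
qed

lemma two_gap_graph_H1: "two_gap_graph H1"
proof -
  interpret pair_graph H1 by (rule pair_graph_H1)
  show ?thesis
  proof
    show diameter_le_2
      by (auto simp: pair_pre_digraph.diameter_le_2_def H1_def)
  next
    fix v assume "v \<in> pverts H1"
    then consider "v = 1" | "v = 2" | "v = 3" | "v = 4" | "v = 5" | "v = 6"
      by (auto simp: H1_def)
    then show "card (gaps v) = 2"
    proof cases
      case 1
      show ?thesis
        by (rule card_gaps_eq_2I[of _ 3 5 4 5]; simp add: 1 pair_pre_digraph.gap_def H1_def doubleton_eq_iff)
    next
      case 2
      show ?thesis
        by (rule card_gaps_eq_2I[of _ 3 5 4 5]; simp add: 2 pair_pre_digraph.gap_def H1_def doubleton_eq_iff)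
    next
      case 3
      show ?thesis
        by (rule card_gaps_eq_2I[of _ 1 6 2 6]; simp add: 3 pair_pre_digraph.gap_def H1_def doubleton_eq_iff)
    next
      case 4
      show ?thesis
        by (rule card_gaps_eq_2I[of _ 1 6 2 6]; simp add: 4 pair_pre_digraph.gap_def H1_def doubleton_eq_iff)
    next
      case 5
      show ?thesis
        by (rule card_gaps_eq_2I[of _ 1 6 2 6]; simp add: 5 pair_pre_digraph.gap_def H1_def doubleton_eq_iff)
    next
      case 6
      show ?thesis
        by (rule card_gaps_eq_2I[of _ 3 5 4 5]; simp add: 6 pair_pre_digraph.gap_def H1_def doubleton_eq_iff)
    qed
  qed
qed

lemma two_gap_graph_H2: "two_gap_graph H2"
proof -
  interpret pair_graph H2 by (rule pair_graph_H2)
  show ?thesis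
  proof
    show diameter_le_2
      by (auto simp: pair_pre_digraph.diameter_le_2_def H2_def)
  next
    fix v assume "v \<in> pverts H2"
    then consider "v = 1" | "v = 2" | "v = 3" | "v = 4" | "v = 5" | "v = 6"
      by (auto simp: H2_def)
    then show "card (gaps v) = 2"
    proof cases
      case 1
      show ?thesis
        by (rule card_gaps_eq_2I[of _ 2 4 3 4]; simp add: 1 pair_pre_digraph.gap_def H2_def doubleton_eq_iff)
    next
      case 2
      show ?thesis
        by (rule card_gaps_eq_2I[of _ 1 5 3 5]; simp add: 2 pair_pre_digraph.gap_def H2_def doubleton_eq_iff)
    next
      case 3
      show ?thesis
        by (rule card_gaps_eq_2I[of _ 1 6 2 6]; simp add: 3 pair_pre_digraph.gap_def H2_def doubleton_eq_iff)
    next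
      case 4
      show ?thesis
        by (rule card_gaps_eq_2I[of _ 1 5 1 6]; simp add: 4 pair_pre_digraph.gap_def H2_def doubleton_eq_iff)
    next
      case 5
      show ?thesis
        by (rule card_gaps_eq_2I[of _ 2 4 2 6]; simp add: 5 pair_pre_digraph.gap_def H2_def doubleton_eq_iff)
    next
      case 6
      show ?thesis
        by (rule card_gaps_eq_2I[of _ 3 4 3 5]; simp add: 6 pair_pre_digraph.gap_def H2_def doubleton_eq_iff)
    qed
  qed
qed

lemma two_gap_graph_H3: "two_gap_graph H3"
proof -
  interpret pair_graph H3 by (rule pair_graph_H3)
  show ?thesis
  proof
    show diameter_le_2
      by (auto simp: pair_pre_digraph.diameter_le_2_def H3_edges)
  next
    fix v assume "v \<in> pverts H3"
    then consider "v = 1" | "v = 2" | "v = 3" | "v = 4" | "v = 5" | "v = 6"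
      by (auto simp: H3_edges)
    then show "card (gaps v) = 2"
    proof cases
      case 1
      show ?thesis
        by (rule card_gaps_eq_2I[of _ 2 5 3 6]; simp add: 1 pair_pre_digraph.gap_def H3_edges doubleton_eq_iff)
    next
      case 2
      show ?thesis
        by (rule card_gaps_eq_2I[of _ 1 4 3 6]; simp add: 2 pair_pre_digraph.gap_def H3_edges doubleton_eq_iff)
    next
      case 3
      show ?thesis
        by (rule card_gaps_eq_2I[of _ 1 4 2 5]; simp add: 3 pair_pre_digraph.gap_def H3_edges doubleton_eq_iff)
    next
      case 4
      show ?thesis
        by (rule card_gaps_eq_2I[of _ 2 5 3 6]; simp add: 4 pair_pre_digraph.gap_def H3_edges doubleton_eq_iff)
    next
      case 5
      show ?thesis
        by (rule card_gaps_eq_2I[of _ 1 4 3 6]; simp add: 5 pair_pre_digraph.gap_def H3_edges doubleton_eq_iff)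
    next
      case 6
      show ?thesis
        by (rule card_gaps_eq_2I[of _ 1 4 2 5]; simp add: 6 pair_pre_digraph.gap_def H3_edges doubleton_eq_iff)
    qed
  qed
qed

theorem theorem6p6:
  fixes G :: "'a pair_pre_digraph"
  assumes "pair_graph G" and "Digraph_Component.connected (with_proj G)"
  shows "stress_regular 2 G \<longleftrightarrow>
    digraph_iso (with_proj G) (with_proj H1) \<or>
    digraph_iso (with_proj G) (with_proj H2) \<or>
    digraph_iso (with_proj G) (with_proj H3)"
proof -
  interpret pair_graph G by fact
  have "stress_regular 2 G \<longleftrightarrow> two_gap_graph G"
    using stress_regular_2_iff[OF assms(2)] assms(1)
    by (simp add: two_gap_graph_def two_gap_graph_axioms_def Ball_def)
  moreover have "pverts G \<noteq> {}"
    using assms(2) by (simp add: connected_conv)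
  moreover have "two_gap_graph G"
    if "two_gap_graph H" and iso: "digraph_iso (with_proj G) (with_proj H)"
    for H :: "nat pair_pre_digraph"
  proof -
    interpret H: two_gap_graph H by (rule that(1))
    obtain f where f: "bij_betw f (pverts H) (pverts G)"
      "\<And>i j. i \<in> pverts H \<Longrightarrow> j \<in> pverts H \<Longrightarrow> (i, j) \<in> parcs H \<longleftrightarrow> (f i, f j) \<in> parcs G"
      using iso digraph_iso_with_proj_iff[OF pair_wf_digraph_axioms H.pair_wf_digraph_axioms]
      by metis
    then show ?thesis
      by (rule two_gaps_transfer[OF assms(1) H.pair_graph_axioms _ _ that(1)])
  qed
  ultimately show ?thesis
    using two_gap_graph.classification two_gap_graph_H1 two_gap_graph_H2 two_gap_graph_H3 by metis
qed

end
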